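(* Let $n\ge 2$, $N=\binom{n}{2}$, and let $F$ be a fundamental basic block with exactly $n$ reducible elements and nullity $\eta(F)=N$ (denoted $\mathrm{CF}(n)$). Let $u_1<u_2<\cdots<u_n$ be its reducible elements. Then $F$ has the adjunct representation $$F = C_0\,]^{u_2}_{u_1}\{c_1\}\,]^{u_3}_{u_1}\{c_2\}\cdots]^{u_n}_{u_1}\{c_{n-1}\}\,]^{u_3}_{u_2}\{c_n\}\cdots]^{u_j}_{u_i}\{c_k\}\cdots]^{u_n}_{u_{n-1}}\{c_N\},$$ in which every adjunct chain is a singleton $\{c_k\}$, the adjunct pairs are exactly the pairs $(u_i,u_j)$ with $1\le i<j\le n$, each occurring once, the pair $(u_i,u_j)$ carrying $\{c_k\}$ with $k=(i-1)n-\binom{i}{2}+j-i$, and $C_0$ is the maximal chain $u_1\prec x_1\prec u_2\prec x_2\prec\cdots\prec u_{n-1}\prec x_{n-1}\prec u_n$, where $x_i\parallel c_k$ for $k=(i-1)n-\binom{i}{2}+1$ (the element attached to the pair $(u_i,u_{i+1})$). Consequently $|F|=2n-1+\binom{n}{2}$, $F$ has $(2n-2)+2\binom{n}{2}$ coverings, and $\eta(F)=\binom n2$.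
   Context: For a finite poset $P$, $a\prec b$ means $b$ covers $a$; the nullity $\eta(P)$ is $|E|-|V|+c$ for the cover graph of $P$ (undirected graph on $P$ with edges the coverings), $c$ its number of components. $x\parallel y$ means $x,y$ incomparable. An element $x$ of a lattice is join-reducible (meet-reducible) if $x=y\vee z$ ($x=y\wedge z$) for some $y,z$ both different from $x$; reducible if join- or meet-reducible. An element of a poset is doubly irreducible if it has at most one upper cover and at most one lower cover. Adjunct operation: for disjoint lattices $L_1,L_2$ and $a<b$ in $L_1$ with $a\not\prec b$, $L_1\,]_a^b\,L_2$ is $L_1\cup L_2$ ordered by: $x\le y$ iff $x\le y$ within $L_1$ or within $L_2$, or $x\in L_1$, $y\in L_2$, $x\le a$, or $x\in L_2$, $y\in L_1$, $b\le y$; $(a,b)$ is the adjunct pair. An RC-lattice is a finite lattice whose reducible elements are pairwise comparable; every RC-lattice is dismantlable and hence an adjunct of chains $C_0\,]_{a_1}^{b_1}C_1\cdots]_{a_r}^{b_r}C_r$ with $C_0$ a maximal chain, the representation being unique up to the order of the adjunct pairs. A poset $B$ is a basic block if it has one element, or has no doubly irreducible elements, or removal of (any) doubly irreducible element from $B$ reduces its nullity by one. A fundamental basic block is an RC-lattice that is a basic block and in whose adjunct representation all adjunct pairs are distinct. *)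

theory Defs
  imports Main
begin

text \<open>Finite posets are represented by a carrier set V together with an order
relation le (only its restriction to V matters).\<close>

type_synonym 'a poset = "'a set \<times> ('a \<Rightarrow> 'a \<Rightarrow> bool)"

definition partial_order_on :: "'a set \<Rightarrow> ('a \<Rightarrow> 'a \<Rightarrow> bool) \<Rightarrow> bool" where
  "partial_order_on V le \<longleftrightarrow>
     (\<forall>x\<in>V. le x x) \<and>
     (\<forall>x\<in>V. \<forall>y\<in>V. le x y \<and> le y x \<longrightarrow> x = y) \<and>
     (\<forall>x\<in>V. \<forall>y\<in>V. \<forall>z\<in>V. le x y \<and> le y z \<longrightarrow> le x z)"

definition covers :: "'a set \<Rightarrow> ('a \<Rightarrow> 'a \<Rightarrow> bool) \<Rightarrow> 'a \<Rightarrow> 'a \<Rightarrow> bool" where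
  "covers V le a b \<longleftrightarrow> a \<in> V \<and> b \<in> V \<and> le a b \<and> a \<noteq> b \<and>
     \<not> (\<exists>z\<in>V. le a z \<and> le z b \<and> z \<noteq> a \<and> z \<noteq> b)"

definition incomparable :: "('a \<Rightarrow> 'a \<Rightarrow> bool) \<Rightarrow> 'a \<Rightarrow> 'a \<Rightarrow> bool" where
  "incomparable le x y \<longleftrightarrow> \<not> le x y \<and> \<not> le y x"

definition coverings :: "'a set \<Rightarrow> ('a \<Rightarrow> 'a \<Rightarrow> bool) \<Rightarrow> ('a \<times> 'a) set" where
  "coverings V le = {(a, b). covers V le a b}"

definition cover_edges :: "'a set \<Rightarrow> ('a \<Rightarrow> 'a \<Rightarrow> bool) \<Rightarrow> 'a set set" where
  "cover_edges V le = {{a, b} | a b. covers V le a b}"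

definition cover_conn :: "'a set \<Rightarrow> ('a \<Rightarrow> 'a \<Rightarrow> bool) \<Rightarrow> ('a \<times> 'a) set" where
  "cover_conn V le =
     ({(a, b). covers V le a b \<or> covers V le b a})\<^sup>* \<inter> (V \<times> V)"

definition num_components :: "'a set \<Rightarrow> ('a \<Rightarrow> 'a \<Rightarrow> bool) \<Rightarrow> nat" where
  "num_components V le = card (V // cover_conn V le)"

definition nullity :: "'a set \<Rightarrow> ('a \<Rightarrow> 'a \<Rightarrow> bool) \<Rightarrow> int" where
  "nullity V le = int (card (cover_edges V le)) - int (card V) + int (num_components V le)"

definition is_lub :: "'a set \<Rightarrow> ('a \<Rightarrow> 'a \<Rightarrow> bool) \<Rightarrow> 'a \<Rightarrow> 'a \<Rightarrow> 'a \<Rightarrow> bool" where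
  "is_lub V le x y z \<longleftrightarrow> z \<in> V \<and> le x z \<and> le y z \<and> (\<forall>w\<in>V. le x w \<and> le y w \<longrightarrow> le z w)"

definition is_glb :: "'a set \<Rightarrow> ('a \<Rightarrow> 'a \<Rightarrow> bool) \<Rightarrow> 'a \<Rightarrow> 'a \<Rightarrow> 'a \<Rightarrow> bool" where
  "is_glb V le x y z \<longleftrightarrow> z \<in> V \<and> le z x \<and> le z y \<and> (\<forall>w\<in>V. le w x \<and> le w y \<longrightarrow> le w z)"

definition finite_lattice :: "'a set \<Rightarrow> ('a \<Rightarrow> 'a \<Rightarrow> bool) \<Rightarrow> bool" where
  "finite_lattice V le \<longleftrightarrow> finite V \<and> V \<noteq> {} \<and> partial_order_on V le \<and>
     (\<forall>x\<in>V. \<forall>y\<in>V. (\<exists>z. is_lub V le x y z) \<and> (\<exists>z. is_glb V le x y z))"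

definition join_reducible :: "'a set \<Rightarrow> ('a \<Rightarrow> 'a \<Rightarrow> bool) \<Rightarrow> 'a \<Rightarrow> bool" where
  "join_reducible V le x \<longleftrightarrow> (\<exists>y\<in>V. \<exists>z\<in>V. y \<noteq> x \<and> z \<noteq> x \<and> is_lub V le y z x)"

definition meet_reducible :: "'a set \<Rightarrow> ('a \<Rightarrow> 'a \<Rightarrow> bool) \<Rightarrow> 'a \<Rightarrow> bool" where
  "meet_reducible V le x \<longleftrightarrow> (\<exists>y\<in>V. \<exists>z\<in>V. y \<noteq> x \<and> z \<noteq> x \<and> is_glb V le y z x)"

definition reducible :: "'a set \<Rightarrow> ('a \<Rightarrow> 'a \<Rightarrow> bool) \<Rightarrow> 'a \<Rightarrow> bool" where
  "reducible V le x \<longleftrightarrow> join_reducible V le x \<or> meet_reducible V le x"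

definition reducibles :: "'a set \<Rightarrow> ('a \<Rightarrow> 'a \<Rightarrow> bool) \<Rightarrow> 'a set" where
  "reducibles V le = {x \<in> V. reducible V le x}"

definition doubly_irreducible :: "'a set \<Rightarrow> ('a \<Rightarrow> 'a \<Rightarrow> bool) \<Rightarrow> 'a \<Rightarrow> bool" where
  "doubly_irreducible V le x \<longleftrightarrow> x \<in> V \<and>
     card {y. covers V le x y} \<le> 1 \<and> card {y. covers V le y x} \<le> 1"

definition basic_block :: "'a set \<Rightarrow> ('a \<Rightarrow> 'a \<Rightarrow> bool) \<Rightarrow> bool" where
  "basic_block V le \<longleftrightarrow> card V = 1 \<or>
     (\<forall>x\<in>V. \<not> doubly_irreducible V le x) \<or>
     (\<forall>x. doubly_irreducible V le x \<longrightarrow> nullity (V - {x}) le = nullity V le - 1)"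

definition RC_lattice :: "'a set \<Rightarrow> ('a \<Rightarrow> 'a \<Rightarrow> bool) \<Rightarrow> bool" where
  "RC_lattice V le \<longleftrightarrow> finite_lattice V le \<and>
     (\<forall>x\<in>reducibles V le. \<forall>y\<in>reducibles V le. le x y \<or> le y x)"

definition is_chain :: "('a \<Rightarrow> 'a \<Rightarrow> bool) \<Rightarrow> 'a set \<Rightarrow> bool" where
  "is_chain le S \<longleftrightarrow> (\<forall>x\<in>S. \<forall>y\<in>S. le x y \<or> le y x)"

definition maximal_chain :: "'a set \<Rightarrow> ('a \<Rightarrow> 'a \<Rightarrow> bool) \<Rightarrow> 'a set \<Rightarrow> bool" where
  "maximal_chain V le S \<longleftrightarrow> S \<subseteq> V \<and> is_chain le S \<and>
     (\<forall>T. S \<subset> T \<and> T \<subseteq> V \<longrightarrow> \<not> is_chain le T)"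

text \<open>A chain is given as a list listing its elements from bottom to top.\<close>
definition chain_le :: "'a list \<Rightarrow> 'a \<Rightarrow> 'a \<Rightarrow> bool" where
  "chain_le C x y \<longleftrightarrow> (\<exists>i j. i \<le> j \<and> j < length C \<and> C ! i = x \<and> C ! j = y)"

definition chain_poset :: "'a list \<Rightarrow> 'a poset" where
  "chain_poset C = (set C, chain_le C)"

definition adjunct :: "'a poset \<Rightarrow> 'a \<Rightarrow> 'a \<Rightarrow> 'a list \<Rightarrow> 'a poset" where
  "adjunct P a b C =
     (fst P \<union> set C,
      \<lambda>x y. (x \<in> fst P \<and> y \<in> fst P \<and> snd P x y) \<or>
            (x \<in> set C \<and> y \<in> set C \<and> chain_le C x y) \<or>
            (x \<in> fst P \<and> y \<in> set C \<and> snd P x a) \<or>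
            (x \<in> set C \<and> y \<in> fst P \<and> snd P b y))"

fun adj_iter :: "'a poset \<Rightarrow> ('a \<times> 'a \<times> 'a list) list \<Rightarrow> 'a poset" where
  "adj_iter P [] = P"
| "adj_iter P ((a, b, C) # s) = adj_iter (adjunct P a b C) s"

fun adj_valid :: "'a poset \<Rightarrow> ('a \<times> 'a \<times> 'a list) list \<Rightarrow> bool" where
  "adj_valid P [] = True"
| "adj_valid P ((a, b, C) # s) \<longleftrightarrow>
     a \<in> fst P \<and> b \<in> fst P \<and> snd P a b \<and> a \<noteq> b \<and> \<not> covers (fst P) (snd P) a b \<and>
     C \<noteq> [] \<and> distinct C \<and> set C \<inter> fst P = {} \<and>
     adj_valid (adjunct P a b C) s"

definition adj_rep :: "'a set \<Rightarrow> ('a \<Rightarrow> 'a \<Rightarrow> bool) \<Rightarrow> 'a list \<Rightarrow> ('a \<times> 'a \<times> 'a list) list \<Rightarrow> bool" where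
  "adj_rep V le C0 steps \<longleftrightarrow>
     C0 \<noteq> [] \<and> distinct C0 \<and> maximal_chain V le (set C0) \<and>
     adj_valid (chain_poset C0) steps \<and>
     fst (adj_iter (chain_poset C0) steps) = V \<and>
     (\<forall>x\<in>V. \<forall>y\<in>V. snd (adj_iter (chain_poset C0) steps) x y = le x y)"

definition adj_pairs :: "('a \<times> 'a \<times> 'a list) list \<Rightarrow> ('a \<times> 'a) list" where
  "adj_pairs steps = map (\<lambda>(a, b, C). (a, b)) steps"

definition fundamental_basic_block :: "'a set \<Rightarrow> ('a \<Rightarrow> 'a \<Rightarrow> bool) \<Rightarrow> bool" where
  "fundamental_basic_block V le \<longleftrightarrow> RC_lattice V le \<and> basic_block V le \<and>
     (\<exists>C0 steps. adj_rep V le C0 steps \<and> distinct (adj_pairs steps))"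

definition pair_index :: "nat \<Rightarrow> nat \<Rightarrow> nat \<Rightarrow> nat" where
  "pair_index n i j = (i - 1) * n - (i choose 2) + (j - i)"

definition CF_chain :: "nat \<Rightarrow> (nat \<Rightarrow> 'a) \<Rightarrow> (nat \<Rightarrow> 'a) \<Rightarrow> 'a list" where
  "CF_chain n u x = concat (map (\<lambda>i. [u i, x i]) [1..<n]) @ [u n]"

definition CF_steps :: "nat \<Rightarrow> (nat \<Rightarrow> 'a) \<Rightarrow> (nat \<Rightarrow> 'a) \<Rightarrow> ('a \<times> 'a \<times> 'a list) list" where
  "CF_steps n u c = concat (map (\<lambda>i. map (\<lambda>j. (u i, u j, [c (pair_index n i j)])) [Suc i..<Suc n]) [1..<n])"

end

theory Submission
  imports Defs
begin

text \<open>
  In a basic block every irreducible element x has exactly one lower cover p and one upper cover q: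
  otherwise deleting x would not lower the nullity. The same count gives a second element
  strictly between p and q, which forces p and q to be reducible. Hence the lattice consists of the
  chain u 1 < ... < u n together with, for each i < j, the set D i j of irreducible
  elements that cover u i and are covered by u j.

  Distinctness of the adjunct pairs bounds these sets. An element of D i j
  lies either on the chain that introduced the later one of u i, u j, or on a chain
  adjoined at the pair (u i, u j) itself, so D i j has at most two elements. If some u k lies
  strictly between, then the pair (u i, u j) is used up by a chain through such a u k, and at most
  one element remains.

  With m irreducible elements and t coverings u i < u (i + 1), the nullity is m + t - n + 1. The value
  n choose 2 is therefore attained only if all bounds are equalities and t = 0: two elements in
  D i (i + 1), one element in every other D i j. One element of each D i (i + 1)
  goes into the base chain and the remaining ones are adjoined as singletons.
\<close>

section \<open>Finite posets\<close>

locale fin_poset =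
  fixes V :: "'a set" and le :: "'a \<Rightarrow> 'a \<Rightarrow> bool"
  assumes finite_carrier: "finite V" and po: "partial_order_on V le"
begin

lemma le_refl: "x \<in> V \<Longrightarrow> le x x"
  using po unfolding partial_order_on_def by blast

lemma le_antisym: "le x y \<Longrightarrow> le y x \<Longrightarrow> x \<in> V \<Longrightarrow> y \<in> V \<Longrightarrow> x = y"
  using po unfolding partial_order_on_def by blast

lemma le_trans: "le x y \<Longrightarrow> le y z \<Longrightarrow> x \<in> V \<Longrightarrow> y \<in> V \<Longrightarrow> z \<in> V \<Longrightarrow> le x z"
  using po unfolding partial_order_on_def by blast

lemma dual: "fin_poset V (\<lambda>x y. le y x)"
  using finite_carrier po unfolding partial_order_on_def
  by unfold_locales (simp, unfold partial_order_on_def, blast)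

lemma fin_poset_subset: "W \<subseteq> V \<Longrightarrow> fin_poset W le"
  using finite_carrier po unfolding partial_order_on_def
  by unfold_locales (metis finite_subset, unfold partial_order_on_def, blast)

text \<open>Induction on the size of the interval from \<open>a\<close> to \<open>b\<close>: an
  element strictly inside gives a smaller interval with the same top.\<close>

lemma exists_lower_cover:
  assumes "a \<in> V" "b \<in> V" "le a b" "a \<noteq> b"
  shows "\<exists>p. covers V le p b \<and> le a p"
  using assms
proof (induction "card {z \<in> V. le a z \<and> le z b}" arbitrary: a rule: less_induct)
  case less
  show ?case
  proof (cases "covers V le a b")
    case True
    then show ?thesis using le_refl less.prems by blast
  next
    case False
    then obtain z where z: "z \<in> V" "le a z" "le z b" "z \<noteq> a" "z \<noteq> b"
      using less.prems by (auto simp: covers_def)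
    have "{w \<in> V. le z w \<and> le w b} \<subset> {w \<in> V. le a w \<and> le w b}"
    proof
      show "{w \<in> V. le z w \<and> le w b} \<subseteq> {w \<in> V. le a w \<and> le w b}"
        using z less.prems le_trans by blast
      have "\<not> le z a" using z less.prems le_antisym by blast
      then show "{w \<in> V. le z w \<and> le w b} \<noteq> {w \<in> V. le a w \<and> le w b}"
        using le_refl less.prems by blast
    qed
    then have "card {w \<in> V. le z w \<and> le w b} < card {w \<in> V. le a w \<and> le w b}"
      by (intro psubset_card_mono) (auto simp: finite_carrier)
    from less.hyps[OF this] z less.prems obtain p where p: "covers V le p b" "le z p" by blast
    then have "p \<in> V" by (simp add: covers_def)
    then show ?thesis using p z less.prems le_trans[of a z p] by blast
  qed
qed

end

section \<open>Order duality\<close>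

lemma covers_dual: "covers V (\<lambda>x y. le y x) a b = covers V le b a"
  by (auto simp: covers_def)

lemma glb_dual: "is_glb V (\<lambda>x y. le y x) a b = is_lub V le a b"
  by (auto simp: is_glb_def is_lub_def fun_eq_iff)

lemma lub_dual: "is_lub V (\<lambda>x y. le y x) a b = is_glb V le a b"
  by (auto simp: is_glb_def is_lub_def fun_eq_iff)

lemma reducible_dual: "reducible V (\<lambda>x y. le y x) = reducible V le"
  by (auto simp: reducible_def join_reducible_def meet_reducible_def glb_dual[of V le] lub_dual[of V le] fun_eq_iff)

lemma (in fin_poset) exists_upper_cover:
  assumes "a \<in> V" "b \<in> V" "le a b" "a \<noteq> b"
  shows "\<exists>p. covers V le a p \<and> le p b"
  using fin_poset.exists_lower_cover[OF dual, of b a] assms by (auto simp: covers_dual[of V le])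

section \<open>Adjuncts of chains\<close>

text \<open>For \<open>p = u i\<close> and \<open>q = u j\<close> this is the set
  \<open>D i j\<close> of the overview.\<close>

definition links :: "'a set \<Rightarrow> ('a \<Rightarrow> 'a \<Rightarrow> bool) \<Rightarrow> 'a \<Rightarrow> 'a \<Rightarrow> 'a set" where
  "links V le p q = {x \<in> V. \<not> reducible V le x \<and> covers V le p x \<and> covers V le x q}"

text \<open>A comparable \<open>r\<close> would lie between \<open>p\<close> and \<open>x\<close> or
  between \<open>x\<close> and \<open>q\<close>, and both of these are coverings.\<close>

lemma links_comparable:
  assumes "x \<in> links V le p q" "r \<in> V" "le p r" "le r q" "r \<noteq> p" "r \<noteq> q" "le x r \<or> le r x"
  shows "x = r"
  using assms unfolding links_def covers_def by blast

text \<open>An adjunct of chains, seen from the final poset: lev x is the index of the chain containing x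
  (0 for the base chain), and chain k is adjoined at the pair (A k, B k).\<close>

locale levelled = fin_poset +
  fixes lev :: "'a \<Rightarrow> nat" and A B :: "nat \<Rightarrow> 'a" and K :: nat
  assumes pair_carrier: "1 \<le> k \<Longrightarrow> k \<le> K \<Longrightarrow> A k \<in> V \<and> B k \<in> V"
    and pair_lev: "1 \<le> k \<Longrightarrow> k \<le> K \<Longrightarrow> lev (A k) < k \<and> lev (B k) < k"
    and below_iff: "x \<in> V \<Longrightarrow> y \<in> V \<Longrightarrow> lev x < lev y \<Longrightarrow> le x y \<longleftrightarrow> le x (A (lev y))"
    and above_iff: "x \<in> V \<Longrightarrow> y \<in> V \<Longrightarrow> lev x < lev y \<Longrightarrow> le y x \<longleftrightarrow> le (B (lev y)) x"
    and same_lev: "x \<in> V \<Longrightarrow> y \<in> V \<Longrightarrow> lev x = lev y \<Longrightarrow> le x y \<or> le y x"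
    and lev_le: "x \<in> V \<Longrightarrow> lev x \<le> K"
    and lev_nonempty: "1 \<le> k \<Longrightarrow> k \<le> K \<Longrightarrow> \<exists>c\<in>V. lev c = k"
    and pair_between: "1 \<le> k \<Longrightarrow> k \<le> K \<Longrightarrow>
      \<exists>z\<in>V. lev z < k \<and> le (A k) z \<and> le z (B k) \<and> z \<noteq> A k \<and> z \<noteq> B k"
    and pair_inj: "inj_on (\<lambda>k. (A k, B k)) {1..K}"
begin

text \<open>Reversing the order exchanges \<open>A\<close> and \<open>B\<close>, so each fact about
  lower ends or lower covers yields its upper counterpart.\<close>

lemma levelled_dual: "levelled V (\<lambda>x y. le y x) lev B A K"
proof -
  interpret d: fin_poset V "\<lambda>x y. le y x" by (rule dual)
  show ?thesis
  proof (unfold_locales, goal_cases)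
    case (1 k) then show ?case using pair_carrier by simp
  next
    case (2 k) then show ?case using pair_lev by simp
  next
    case (3 x y) then show ?case by (rule above_iff)
  next
    case (4 x y) then show ?case by (rule below_iff)
  next
    case (5 x y) then show ?case using same_lev[of y x] by simp
  next
    case (6 x) then show ?case by (rule lev_le)
  next
    case (7 k) then show ?case by (rule lev_nonempty)
  next
    case (8 k) then show ?case using pair_between[of k] by blast
  next
    case 9 show ?case
      using pair_inj unfolding inj_on_def prod.inject by blast
  qed
qed

text \<open>Applying \<open>above_iff\<close> to \<open>B (lev x)\<close> itself, which has a
  smaller level, reduces the claim to reflexivity.\<close>

lemma le_B:
  assumes x: "x \<in> V" "1 \<le> lev x"
  shows "le x (B (lev x)) \<and> x \<noteq> B (lev x)"
proof -
  have K: "lev x \<le> K" using lev_le x by simp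
  note B = pair_carrier[OF x(2) K] pair_lev[OF x(2) K]
  have "le (B (lev x)) (B (lev x))" using B le_refl by blast
  then have "le x (B (lev x))" using above_iff x B by blast
  moreover have "x \<noteq> B (lev x)" using B by force
  ultimately show ?thesis by blast
qed

lemma A_le: "x \<in> V \<Longrightarrow> 1 \<le> lev x \<Longrightarrow> le (A (lev x)) x \<and> x \<noteq> A (lev x)"
  using levelled.le_B[OF levelled_dual] by blast

text \<open>\<open>A k\<close> is the meet of an element \<open>c\<close> of chain \<open>k\<close>
  and an earlier element \<open>z\<close> strictly inside the pair. Common lower bounds are pushed
  below \<open>A k\<close> by induction on their level.\<close>

lemma A_reducible:
  assumes k: "1 \<le> k" "k \<le> K"
  shows "reducible V le (A k)"
proof -
  obtain c where c: "c \<in> V" "lev c = k" using lev_nonempty k by blast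
  obtain z where z: "z \<in> V" "lev z < k" "le (A k) z" "le z (B k)" "z \<noteq> A k" "z \<noteq> B k"
    using pair_between k by blast
  have low: "le w (A k)" if "w \<in> V" "le w c" "le w z" for w
    using that
  proof (induction "lev w" arbitrary: w rule: less_induct)
    case less
    consider "lev w < k" | "lev w = k" | "lev w > k" by linarith
    then show ?case
    proof cases
      case 1
      then show ?thesis using below_iff c less.prems by blast
    next
      case 2
      then have "le (B k) z" using above_iff z less.prems by blast
      then show ?thesis using le_antisym z pair_carrier k by blast
    next
      case 3
      \<comment> \<open>Anything earlier that lies above \<open>w\<close> lies above the upper end
        of the chain of \<open>w\<close>, so \<open>?b\<close> is again a common lower bound, of
        smaller level.\<close>
      let ?b = "B (lev w)"
      have b: "?b \<in> V" "lev ?b < lev w"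
        using pair_carrier[of "lev w"] pair_lev[of "lev w"] lev_le[of w] less.prems 3 by auto
      have "le ?b c" "le ?b z" using above_iff 3 c z less.prems by auto
      then have "le ?b (A k)" using less.hyps b by blast
      moreover have "le w ?b" using le_B 3 less.prems by auto
      ultimately show ?thesis using le_trans b pair_carrier k less.prems by blast
    qed
  qed
  have "is_glb V le c z (A k)"
    using low z A_le[of c] c k pair_carrier by (auto simp: is_glb_def)
  then show ?thesis using c z A_le[of c] k
    unfolding reducible_def meet_reducible_def by auto
qed

lemma B_reducible: "1 \<le> k \<Longrightarrow> k \<le> K \<Longrightarrow> reducible V le (B k)"
  using levelled.A_reducible[OF levelled_dual] by (simp add: reducible_dual[of V le])

text \<open>If \<open>p\<close> had the larger level, the upper end of its chain would lie between
  \<open>p\<close> and \<open>x\<close>, hence equal \<open>x\<close>, but such ends are reducible.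
  From a smaller level \<open>x\<close> can only be reached through
  \<open>A (lev x)\<close>.\<close>

lemma lower_cover_lev:
  assumes "covers V le p x" "\<not> reducible V le x"
  shows "lev p \<le> lev x" "lev p < lev x \<Longrightarrow> p = A (lev x)"
proof -
  have V: "p \<in> V" "x \<in> V" "le p x" using assms by (auto simp: covers_def)
  show "lev p \<le> lev x"
  proof (rule ccontr)
    assume l: "\<not> lev p \<le> lev x"
    let ?b = "B (lev p)"
    have K: "1 \<le> lev p" "lev p \<le> K" using l lev_le V by auto
    have "le ?b x" using above_iff V l by auto
    moreover have "le p ?b" "?b \<noteq> p" using le_B[of p] V K by auto
    ultimately have "?b = x" using assms(1) pair_carrier[OF K] unfolding covers_def by blast
    then show False using B_reducible[OF K] assms by simp
  qed
  show "p = A (lev x)" if l: "lev p < lev x"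
  proof -
    have K: "1 \<le> lev x" "lev x \<le> K" using l lev_le V by auto
    have "le p (A (lev x))" using below_iff V l by auto
    then show ?thesis using assms(1) A_le[OF V(2) K(1)] pair_carrier[OF K] unfolding covers_def by metis
  qed
qed

lemma upper_cover_lev:
  assumes "covers V le x q" "\<not> reducible V le x"
  shows "lev q \<le> lev x" "lev q < lev x \<Longrightarrow> q = B (lev x)"
  using levelled.lower_cover_lev[OF levelled_dual, of q x] assms by (simp_all add: reducible_dual[of V le] covers_dual[of V le])

lemma links_same_lev:
  assumes "x \<in> links V le p q" "y \<in> links V le p q" "lev x = lev y"
  shows "x = y"
proof -
  have "y \<in> V" "le p y" "le y q" "y \<noteq> p" "y \<noteq> q" using assms(2) by (auto simp: links_def covers_def)
  moreover have "x \<in> V" using assms(1) by (auto simp: links_def)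
  ultimately show ?thesis using links_comparable[OF assms(1)] same_lev assms(3) by blast
qed

text \<open>Neither cover has a level above that of \<open>x\<close>; once equality is excluded for
  both, they are the ends at which the chain of \<open>x\<close> is adjoined.\<close>

lemma links_lev:
  assumes x: "x \<in> links V le p q" and "lev x \<noteq> max (lev p) (lev q)"
  shows "1 \<le> lev x \<and> lev x \<le> K \<and> A (lev x) = p \<and> B (lev x) = q"
  using assms lower_cover_lev[of p x] upper_cover_lev[of x q] lev_le[of x]
  unfolding links_def by fastforce

text \<open>Distinctness of the adjunct pairs puts both elements on one chain, where they are
  comparable.\<close>

lemma links_lev_unique:
  assumes x: "x \<in> links V le p q" "lev x \<noteq> max (lev p) (lev q)"
    and y: "y \<in> links V le p q" "lev y \<noteq> max (lev p) (lev q)"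
  shows "x = y"
proof -
  have "lev x = lev y"
    using links_lev[OF x] links_lev[OF y] pair_inj by (auto dest: inj_onD)
  then show ?thesis using links_same_lev x y by blast
qed

lemma finite_links: "finite (links V le p q)"
  using finite_carrier by (simp add: links_def)

text \<open>One element at most lies on the level \<open>max (lev p) (lev q)\<close>, and one at
  most lies off it.\<close>

lemma card_links_le_2: "card (links V le p q) \<le> 2"
proof -
  let ?L = "{x \<in> links V le p q. lev x = max (lev p) (lev q)}"
  let ?M = "{x \<in> links V le p q. lev x \<noteq> max (lev p) (lev q)}"
  have "card ?L \<le> 1"
    using finite_links[of p q] links_same_lev[of _ p q] by (auto simp: card_le_Suc0_iff_eq)
  moreover have "card ?M \<le> 1"
    using finite_links[of p q] links_lev_unique[of _ p q] by (auto simp: card_le_Suc0_iff_eq)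
  moreover have "card (links V le p q) \<le> card ?L + card ?M"
    by (rule order_trans[OF _ card_Un_le]) (auto intro!: card_mono finite_links)
  ultimately show ?thesis by linarith
qed

text \<open>A reducible element strictly between p and q of least level sits on a chain adjoined at (p, q),
  which uses up the only occurrence of that pair.\<close>

lemma card_links_le_1:
  assumes r: "r \<in> V" "reducible V le r" "le p r" "le r q" "r \<noteq> p" "r \<noteq> q"
  shows "card (links V le p q) \<le> 1"
proof (rule ccontr)
  assume "\<not> card (links V le p q) \<le> 1"
  then obtain x0 y0 where xy: "x0 \<in> links V le p q" "y0 \<in> links V le p q" "x0 \<noteq> y0"
    using finite_links[of p q] by (auto simp: card_le_Suc0_iff_eq)
  let ?k = "max (lev p) (lev q)"
  \<comment> \<open>Two different links can neither both lie on level \<open>?k\<close> nor both lie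
    off it.\<close>
  obtain x y where x: "x \<in> links V le p q" "lev x = ?k" and y: "y \<in> links V le p q" "lev y \<noteq> ?k"
    using xy links_lev_unique links_same_lev by metis
  define S where "S = {r \<in> V. reducible V le r \<and> le p r \<and> le r q \<and> r \<noteq> p \<and> r \<noteq> q}"
  have "r \<in> S" using r by (simp add: S_def)
  then obtain r where rS: "r \<in> S" and rmin: "\<And>s. s \<in> S \<Longrightarrow> lev r \<le> lev s"
    using ex_has_least_nat[of "\<lambda>r. r \<in> S" r lev] by blast
  have r: "r \<in> V" "reducible V le r" "le p r" "le r q" "r \<noteq> p" "r \<noteq> q"
    using rS by (auto simp: S_def)
  have xV: "x \<in> V" "p \<in> V" "q \<in> V" "le p x" "le x q" "\<not> reducible V le x"
    using x by (auto simp: links_def covers_def)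
  have yV: "y \<in> V" "\<not> reducible V le y"
    using y by (auto simp: links_def covers_def)
  have inc: "\<not> le z r" "\<not> le r z" if "z \<in> links V le p q" for z
    using links_comparable[OF that r(1,3-6)] that r(2) by (auto simp: links_def)
  consider "lev r < ?k" | "lev r = ?k" | "lev r > ?k" by linarith
  then show False
  proof cases
    case 1
    \<comment> \<open>Either \<open>p\<close> or \<open>q\<close> lies on level \<open>?k\<close>,
      like \<open>x\<close>, while \<open>r\<close> is earlier. The end of that chain which
      separates \<open>r\<close> from \<open>p\<close> or \<open>q\<close> then also makes
      \<open>r\<close> comparable with \<open>x\<close>.\<close>
    have K: "1 \<le> ?k" "?k \<le> K" using 1 lev_le xV by auto
    show False
    proof (cases "lev p = ?k")
      case True
      have "le (B ?k) r" using above_iff[of r p] 1 r xV True by auto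
      moreover have "le x (B ?k)" using le_B[of x] xV x K by auto
      ultimately have "le x r" using le_trans pair_carrier[OF K] r xV by blast
      then show False using inc x by blast
    next
      case False
      then have True: "lev q = ?k" by linarith
      have "le r (A ?k)" using below_iff[of r q] 1 r xV True by auto
      moreover have "le (A ?k) x" using A_le[of x] xV x K by auto
      ultimately have "le r x" using le_trans pair_carrier[OF K] r xV by blast
      then show False using inc x by blast
    qed
  next
    case 2
    then show False using same_lev[of x r] inc[OF x(1)] x r xV by auto
  next
    case 3
    \<comment> \<open>The ends of the chain of \<open>r\<close> are reducible, lie between
      \<open>p\<close> and \<open>q\<close> and have smaller level than \<open>r\<close>. By
      minimality of \<open>r\<close> they must be \<open>p\<close> and \<open>q\<close>.\<close>
    let ?s = "lev r"
    have K: "1 \<le> ?s" "?s \<le> K" using 3 lev_le r by auto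
    note AB = pair_carrier[OF K] pair_lev[OF K]
    have A: "le p (A ?s)" "le (A ?s) r" "A ?s \<noteq> r"
      using below_iff[of p r] A_le[of r] 3 r xV K by auto
    have B: "le (B ?s) q" "le r (B ?s)" "B ?s \<noteq> r"
      using above_iff[of q r] le_B[of r] 3 r xV K by auto
    have "A ?s = p"
    proof (rule ccontr)
      assume "A ?s \<noteq> p"
      moreover have "A ?s \<noteq> q" using A r AB le_antisym xV by blast
      moreover have "le (A ?s) q" using A r AB le_trans xV by blast
      ultimately have "A ?s \<in> S" using A AB A_reducible[OF K] by (simp add: S_def)
      then show False using rmin AB by fastforce
    qed
    moreover have "B ?s = q"
    proof (rule ccontr)
      assume "B ?s \<noteq> q"
      moreover have "B ?s \<noteq> p" using B r AB le_antisym xV by blast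
      moreover have "le p (B ?s)" using B r AB le_trans xV by blast
      ultimately have "B ?s \<in> S" using B AB B_reducible[OF K] by (simp add: S_def)
      then show False using rmin AB by fastforce
    qed
    \<comment> \<open>The chain of \<open>y\<close> is adjoined at \<open>(p, q)\<close> as well, so
      distinct pairs identify it with the chain of \<open>r\<close>.\<close>
    ultimately have "?s = lev y"
      using links_lev[OF y] K pair_inj by (auto dest: inj_onD)
    then show False using same_lev[of y r] inc[OF y(1)] r yV by auto
  qed
qed

end

section \<open>From an adjunct representation to levels\<close>

lemma adj_iter_append: "adj_iter P (s @ t) = adj_iter (adj_iter P s) t"
  by (induction P s rule: adj_iter.induct) auto

lemma adj_valid_append: "adj_valid P (s @ t) \<longleftrightarrow> adj_valid P s \<and> adj_valid (adj_iter P s) t"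
  by (induction P s rule: adj_valid.induct) auto

lemma chain_le_total: "x \<in> set C \<Longrightarrow> y \<in> set C \<Longrightarrow> chain_le C x y \<or> chain_le C y x"
  unfolding chain_le_def in_set_conv_nth by (metis nle_le)

text \<open>Induction on the last adjoined chain, which receives the highest level. The conclusion
  records the pairs so that distinctness of \<open>adj_pairs\<close> becomes
  \<open>pair_inj\<close>; the shift \<open>k - 1\<close> arises because level 0 is the base
  chain.\<close>

lemma adjunct_chains_levelled:
  assumes "adj_valid (chain_poset C0) steps" "distinct (adj_pairs steps)"
    and "fin_poset V le"
    and "fst (adj_iter (chain_poset C0) steps) = V"
    and "\<And>x y. x \<in> V \<Longrightarrow> y \<in> V \<Longrightarrow> snd (adj_iter (chain_poset C0) steps) x y = le x y"
  shows "\<exists>lev A B. levelled V le lev A B (length steps) \<and>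
           (\<forall>k\<in>{1..length steps}. (A k, B k) = adj_pairs steps ! (k - 1))"
  using assms
proof (induction steps arbitrary: V rule: rev_induct)
  case Nil
  interpret fin_poset V le by fact
  have V: "set C0 = V" using Nil by (simp add: chain_poset_def)
  have tot: "le x y \<or> le y x" if "x \<in> V" "y \<in> V" for x y
    using Nil.prems(5)[of x y] Nil.prems(5)[of y x] that chain_le_total[of x C0 y] V
    by (simp add: chain_poset_def)
  \<comment> \<open>With no adjoined chain the conditions on \<open>A\<close> and \<open>B\<close>
    range over no index, so both are arbitrary.\<close>
  have "levelled V le (\<lambda>_. 0) A B 0" for A B :: "nat \<Rightarrow> 'a"
    by unfold_locales (use tot in auto)
  then show ?case by simp blast
next
  case (snoc st steps)
  obtain a b C where st: "st = (a, b, C)" by (cases st)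
  define P where "P = adj_iter (chain_poset C0) steps"
  define W where "W = fst P"
  define K where "K = length steps"
  interpret fin_poset V le by fact
  have valid: "adj_valid (chain_poset C0) steps" "a \<in> W" "b \<in> W" "snd P a b" "a \<noteq> b"
    "\<not> covers W (snd P) a b" "C \<noteq> []" "set C \<inter> W = {}"
    using snoc.prems(1) by (auto simp: adj_valid_append st P_def W_def)
  have V: "V = W \<union> set C"
    using snoc.prems(4) by (simp add: adj_iter_append st P_def W_def adjunct_def)
  have iter: "snd (adjunct P a b C) x y = le x y" if "x \<in> V" "y \<in> V" for x y
    using snoc.prems(5)[OF that] by (simp add: adj_iter_append st P_def)
  \<comment> \<open>As \<open>C\<close> is disjoint from \<open>W\<close>, exactly one clause of
    \<open>adjunct\<close> applies to each kind of pair; the next four facts read them off.\<close>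
  have leW: "snd P x y = le x y" if "x \<in> W" "y \<in> W" for x y
    using iter[of x y] that valid(8) V by (auto simp: adjunct_def W_def)
  have leC: "chain_le C x y = le x y" if "x \<in> set C" "y \<in> set C" for x y
    using iter[of x y] that valid(8) V by (auto simp: adjunct_def W_def)
  have below: "le x y = le x a" if "x \<in> W" "y \<in> set C" for x y
    using iter[of x y] leW[of x a] that valid V by (auto simp: adjunct_def W_def)
  have above: "le y x = le b x" if "x \<in> W" "y \<in> set C" for x y
    using iter[of y x] leW[of b x] that valid V by (auto simp: adjunct_def W_def)
  have "fin_poset W le"
    using V by (intro fin_poset_subset) blast
  moreover have "distinct (adj_pairs steps)" using snoc.prems(2) by (simp add: adj_pairs_def)
  ultimately obtain lev A B where l: "levelled W le lev A B K"
    and AB: "\<And>k. k \<in> {1..K} \<Longrightarrow> (A k, B k) = adj_pairs steps ! (k - 1)"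
    using snoc.IH[of W] valid(1) leW unfolding P_def W_def K_def by blast
  interpret l: levelled W le lev A B K by (rule l)
  define lev' where "lev' x = (if x \<in> set C then Suc K else lev x)" for x
  define A' where "A' = A(Suc K := a)"
  define B' where "B' = B(Suc K := b)"
  have levC: "lev' x = Suc K" if "x \<in> set C" for x using that by (simp add: lev'_def)
  have levW: "lev' x = lev x" "lev x \<le> K" if "x \<in> W" for x
    using that valid(8) l.lev_le by (auto simp: lev'_def)
  have A'K: "A' k = A k" "B' k = B k" if "k \<le> K" for k
    using that by (auto simp: A'_def B'_def)
  have A'S: "A' (Suc K) = a" "B' (Suc K) = b" by (auto simp: A'_def B'_def)
  have pairs: "(A' k, B' k) = adj_pairs (steps @ [st]) ! (k - 1)" if "k \<in> {1..Suc K}" for k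
  proof (cases "k = Suc K")
    case True
    then show ?thesis using A'S by (simp add: adj_pairs_def st nth_append K_def)
  next
    case False
    then have "k \<in> {1..K}" using that by auto
    then show ?thesis using AB[of k] A'K[of k] by (auto simp: adj_pairs_def nth_append K_def)
  qed
  have "levelled V le lev' A' B' (Suc K)"
  proof (unfold_locales, goal_cases)
    case (1 k)
    then show ?case using l.pair_carrier[of k] A'K[of k] A'S valid V
      by (cases "k = Suc K") auto
  next
    case (2 k)
    then show ?case using l.pair_carrier[of k] l.pair_lev[of k] A'K[of k] A'S valid levW
      by (cases "k = Suc K") (auto simp: le_imp_less_Suc)
  next
    case (3 x y)
    show ?case
    proof (cases "y \<in> set C")
      case True
      then have "x \<in> W" using 3 levC V by auto
      then show ?thesis using below[OF _ True] levC[OF True] A'S by auto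
    next
      case False
      then have "x \<in> W" "y \<in> W" using 3 levC levW V by fastforce+
      then show ?thesis using l.below_iff[of x y] levW A'K 3 by auto
    qed
  next
    case (4 x y)
    show ?case
    proof (cases "y \<in> set C")
      case True
      then have "x \<in> W" using 4 levC V by auto
      then show ?thesis using above[OF _ True] levC[OF True] A'S by auto
    next
      case False
      then have "x \<in> W" "y \<in> W" using 4 levC levW V by fastforce+
      then show ?thesis using l.above_iff[of x y] levW A'K 4 by auto
    qed
  next
    case (5 x y)
    then have "x \<in> set C \<and> y \<in> set C \<or> x \<in> W \<and> y \<in> W"
      using levC levW V by fastforce
    then show ?case using chain_le_total[of x C y] leC l.same_lev[of x y] levW 5 by auto
  next
    case (6 x)
    then show ?case using levC levW V by fastforce
  next
    case (7 k)
    show ?case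
    proof (cases "k = Suc K")
      case True
      then show ?thesis using valid(7) levC V by (cases C) auto
    next
      case False
      then show ?thesis using l.lev_nonempty[of k] 7 levW V by fastforce
    qed
  next
    case (8 k)
    show ?case
    proof (cases "k = Suc K")
      case True
      obtain z where "z \<in> W" "snd P a z" "snd P z b" "z \<noteq> a" "z \<noteq> b"
        using valid by (auto simp: covers_def)
      then show ?thesis using True A'S leW valid levW V by (auto intro!: bexI[of _ z] simp: le_imp_less_Suc)
    next
      case False
      then obtain z where "z \<in> W" "lev z < k" "le (A k) z" "le z (B k)" "z \<noteq> A k" "z \<noteq> B k"
        using l.pair_between[of k] 8 by auto
      then show ?thesis using False 8 A'K levW V by (auto intro!: bexI[of _ z])
    qed
  next
    case 9
    show ?case
    proof (rule inj_onI)
      fix j k assume jk: "j \<in> {1..Suc K}" "k \<in> {1..Suc K}" "(A' j, B' j) = (A' k, B' k)"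
      then have "adj_pairs (steps @ [st]) ! (j - 1) = adj_pairs (steps @ [st]) ! (k - 1)"
        using pairs by metis
      moreover have "j - 1 < length (adj_pairs (steps @ [st]))" "k - 1 < length (adj_pairs (steps @ [st]))"
        using jk by (auto simp: adj_pairs_def K_def)
      ultimately have "j - 1 = k - 1" using snoc.prems(2) nth_eq_iff_index_eq by blast
      then show "j = k" using jk by auto
    qed
  qed
  then show ?case using pairs unfolding K_def by (intro exI[of _ lev'] exI[of _ A'] exI[of _ B']) simp
qed

section \<open>Nullity and basic blocks\<close>

context fin_poset
begin

lemma finite_coverings: "finite (coverings V le)"
  by (rule finite_subset[of _ "V \<times> V"]) (auto simp: coverings_def covers_def finite_carrier)

text \<open>Antisymmetry forbids reversing a covering, so forgetting the direction of edges
  identifies nothing. The nullity can thus be computed from \<open>coverings\<close>.\<close>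

lemma card_cover_edges: "card (cover_edges V le) = card (coverings V le)"
proof -
  have "cover_edges V le = (\<lambda>(a, b). {a, b}) ` coverings V le"
    by (auto simp: cover_edges_def coverings_def)
  moreover have "inj_on (\<lambda>(a, b). {a, b}) (coverings V le)"
  proof (rule inj_onI, clarify)
    fix a b c d
    assume "(a, b) \<in> coverings V le" "(c, d) \<in> coverings V le" "{a, b} = {c, d}"
    moreover from this have "\<not> (a = d \<and> b = c)"
      using le_antisym[of a b] by (auto simp: coverings_def covers_def)
    ultimately show "a = c \<and> b = d" by (auto simp: doubleton_eq_iff)
  qed
  ultimately show ?thesis by (simp add: card_image)
qed

lemma num_components_pos: "V \<noteq> {} \<Longrightarrow> 1 \<le> num_components V le"
proof -
  assume "V \<noteq> {}"
  then have "V // cover_conn V le \<noteq> {}" by (auto simp: quotient_def)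
  moreover have "finite (V // cover_conn V le)" by (simp add: quotient_def finite_carrier)
  ultimately show ?thesis by (simp add: num_components_def Suc_le_eq card_gt_0_iff)
qed

lemma bot_reaches:
  assumes "m \<in> V" "\<And>x. x \<in> V \<Longrightarrow> le m x" "x \<in> V"
  shows "(m, x) \<in> {(a, b). covers V le a b}\<^sup>*"
  using assms(3)
proof (induction "card {z \<in> V. le z x}" arbitrary: x rule: less_induct)
  case less
  show ?case
  proof (cases "x = m")
    case False
    then obtain p where p: "covers V le p x"
      using exists_lower_cover[of m x] assms less.prems by blast
    then have pV: "p \<in> V" "le p x" "p \<noteq> x" by (auto simp: covers_def)
    have "{z \<in> V. le z p} \<subset> {z \<in> V. le z x}"
    proof
      show "{z \<in> V. le z p} \<subseteq> {z \<in> V. le z x}" using pV less.prems le_trans by blast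
      show "{z \<in> V. le z p} \<noteq> {z \<in> V. le z x}"
        using pV less.prems le_antisym le_refl by blast
    qed
    then have "card {z \<in> V. le z p} < card {z \<in> V. le z x}"
      by (intro psubset_card_mono) (auto simp: finite_carrier)
    then have "(m, p) \<in> {(a, b). covers V le a b}\<^sup>*" using less.hyps pV by blast
    then show ?thesis using p by (meson case_prodI mem_Collect_eq rtrancl.rtrancl_into_rtrancl)
  qed simp
qed

text \<open>Descending along lower covers connects every element to \<open>m\<close>.\<close>

lemma num_components_bot:
  assumes "m \<in> V" "\<And>x. x \<in> V \<Longrightarrow> le m x"
  shows "num_components V le = 1"
proof -
  let ?R = "{(a, b). covers V le a b \<or> covers V le b a}"
  have bot: "(m, x) \<in> ?R\<^sup>*" if "x \<in> V" for x
    using bot_reaches[OF assms that] rtrancl_mono[of "{(a, b). covers V le a b}" ?R] by blast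
  have "sym (?R\<^sup>*)" by (rule sym_rtrancl) (auto simp: sym_def)
  then have "(x, y) \<in> ?R\<^sup>*" if "x \<in> V" "y \<in> V" for x y
    using bot that by (meson rtrancl_trans symD)
  then have "cover_conn V le `` {x} = V" if "x \<in> V" for x
    using that unfolding cover_conn_def by blast
  then have "V // cover_conn V le = {V}" using assms(1) by (auto simp: quotient_def)
  then show ?thesis by (simp add: num_components_def)
qed

text \<open>Deleting x destroys at most one covering below and one above x, and creates the covering (p, q)
  unless another element lies between p and q.\<close>

lemma nullity_drop_covers:
  assumes bot: "m \<in> V" "\<And>x. x \<in> V \<Longrightarrow> le m x"
    and x: "doubly_irreducible V le x" and "2 \<le> card V"
    and drop: "nullity (V - {x}) le = nullity V le - 1"
  shows "\<exists>p q y. {z. covers V le z x} = {p} \<and> {z. covers V le x z} = {q} \<and>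
           y \<in> V \<and> le p y \<and> le y q \<and> y \<noteq> p \<and> y \<noteq> q \<and> y \<noteq> x"
proof -
  interpret d: fin_poset "V - {x}" le by (rule fin_poset_subset) blast
  let ?lo = "{z. covers V le z x}" and ?up = "{z. covers V le x z}"
  define E where "E = {(a, b) \<in> coverings V le. a \<noteq> x \<and> b \<noteq> x}"
  have xV: "x \<in> V" and le1: "card ?lo \<le> 1" "card ?up \<le> 1"
    using x by (auto simp: doubly_irreducible_def)
  have fin: "finite ?lo" "finite ?up"
    by (rule finite_subset[OF _ finite_carrier], auto simp: covers_def)+
  have "V - {x} \<noteq> {}"
  proof
    assume "V - {x} = {}"
    then have "card V \<le> card {x}" by (intro card_mono) auto
    then show False using assms(4) by simp
  qed
  then have "1 \<le> num_components (V - {x}) le" by (rule d.num_components_pos)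
  moreover have "num_components V le = 1" by (rule num_components_bot[OF bot])
  moreover have "card (V - {x}) = card V - 1" "card V \<ge> 1"
    using xV finite_carrier assms(4) by auto
  \<comment> \<open>The smaller poset has one vertex fewer and at least one component, so a drop of
    the nullity by one means a loss of at least two coverings.\<close>
  ultimately have drop2: "card (coverings (V - {x}) le) + 2 \<le> card (coverings V le)"
    using drop unfolding nullity_def card_cover_edges d.card_cover_edges by linarith
  have sub: "E \<subseteq> coverings (V - {x}) le" by (auto simp: E_def coverings_def covers_def)
  have finE: "finite E" using d.finite_coverings sub finite_subset by blast
  have "coverings V le \<subseteq> E \<union> ((\<lambda>z. (z, x)) ` ?lo \<union> (\<lambda>z. (x, z)) ` ?up)"
    by (auto simp: E_def coverings_def)
  then have "card (coverings V le) \<le> card (E \<union> ((\<lambda>z. (z, x)) ` ?lo \<union> (\<lambda>z. (x, z)) ` ?up))"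
    by (intro card_mono) (use finE fin in auto)
  also have "\<dots> \<le> card E + (card ?lo + card ?up)"
    by (intro order_trans[OF card_Un_le] add_mono order_trans[OF card_Un_le] order_refl card_image_le fin)
  finally have E: "card (coverings V le) \<le> card E + (card ?lo + card ?up)" .
  have "card E \<le> card (coverings (V - {x}) le)" using sub d.finite_coverings by (rule card_mono[rotated])
  \<comment> \<open>All coverings in \<open>E\<close> survive, so the two lost ones must be one
    below and one above \<open>x\<close>.\<close>
  then have "card ?lo = 1" "card ?up = 1" using E drop2 le1 by linarith+
  then obtain p q where p: "?lo = {p}" and q: "?up = {q}" by (auto simp: card_1_singleton_iff)
  have px: "p \<in> V" "le p x" "p \<noteq> x" and qx: "q \<in> V" "le x q" "q \<noteq> x"
    using p q by (auto simp: covers_def)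
  have pq: "le p q" "p \<noteq> q" using px qx xV le_trans le_antisym by blast+
  have "\<exists>y. y \<in> V \<and> le p y \<and> le y q \<and> y \<noteq> p \<and> y \<noteq> q \<and> y \<noteq> x"
  proof (rule ccontr)
    assume "\<not> ?thesis"
    \<comment> \<open>With nothing else between them, \<open>p\<close> and \<open>q\<close> would
      form a new covering outside \<open>E\<close>, leaving a net loss of at most one.\<close>
    then have "(p, q) \<in> coverings (V - {x}) le"
      using px qx pq by (auto simp: coverings_def covers_def)
    moreover have "(p, q) \<notin> E"
      using px qx xV by (auto simp: E_def coverings_def covers_def)
    ultimately have "E \<subset> coverings (V - {x}) le" using sub by blast
    then have "card E < card (coverings (V - {x}) le)" using d.finite_coverings by (rule psubset_card_mono[rotated])
    then show False using E drop2 le1 by linarith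
  qed
  then show ?thesis using p q by blast
qed

section \<open>Irreducible elements of a finite lattice\<close>

text \<open>The meet of two different upper covers is \<open>x\<close>, which would make
  \<open>x\<close> meet-reducible.\<close>

lemma upper_covers_unique:
  assumes lat: "\<And>x y. x \<in> V \<Longrightarrow> y \<in> V \<Longrightarrow> \<exists>z. is_glb V le x y z"
    and irr: "\<not> reducible V le x" and y: "covers V le x y" and z: "covers V le x z"
  shows "y = z"
proof (rule ccontr)
  assume ne: "y \<noteq> z"
  have V: "x \<in> V" "y \<in> V" "z \<in> V" "le x y" "le x z" "y \<noteq> x" "z \<noteq> x"
    using y z by (auto simp: covers_def)
  then obtain g where g: "is_glb V le y z g" using lat by blast
  then have gV: "g \<in> V" "le x g" "le g y" "le g z" using V by (auto simp: is_glb_def)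
  have "g = x"
    using y z ne gV unfolding covers_def by blast
  then show False using g irr V unfolding reducible_def meet_reducible_def by blast
qed

end

text \<open>Take \<open>m\<close> with the fewest elements below it: its meet with any
  \<open>x\<close> has the same down-set, hence \<open>m\<close> lies below that meet.\<close>

lemma (in fin_poset) exists_bottom:
  assumes "V \<noteq> {}" and glb: "\<And>x y. x \<in> V \<Longrightarrow> y \<in> V \<Longrightarrow> \<exists>z. is_glb V le x y z"
  shows "\<exists>m\<in>V. \<forall>x\<in>V. le m x"
proof -
  let ?f = "\<lambda>x. card {z \<in> V. le z x}"
  obtain m where m: "m \<in> V" "\<And>y. y \<in> V \<Longrightarrow> ?f m \<le> ?f y"
    using ex_has_least_nat[of "\<lambda>x. x \<in> V" _ ?f] assms(1) by blast
  have "le m x" if xV: "x \<in> V" for x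
  proof -
    obtain g where g: "g \<in> V" "le g m" "le g x"
      using glb[OF m(1) xV] by (auto simp: is_glb_def)
    have "{z \<in> V. le z g} \<subseteq> {z \<in> V. le z m}" using g m(1) le_trans by blast
    moreover have "finite {z \<in> V. le z m}" using finite_carrier by simp
    ultimately have "{z \<in> V. le z g} = {z \<in> V. le z m}"
      using m(2)[OF g(1)] by (intro card_seteq) auto
    then have "le m g" using m(1) le_refl by blast
    then show ?thesis using g m(1) xV le_trans by blast
  qed
  then show ?thesis using m by blast
qed

lemma (in fin_poset) lower_covers_unique:
  assumes "\<And>x y. x \<in> V \<Longrightarrow> y \<in> V \<Longrightarrow> \<exists>z. is_lub V le x y z"
    and "\<not> reducible V le x" "covers V le y x" "covers V le z x"
  shows "y = z"
  using fin_poset.upper_covers_unique[OF dual, of x y z] assms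
  by (simp add: glb_dual[of V le] reducible_dual[of V le] covers_dual[of V le])

text \<open>Passes from irreducibility by joins and meets to the count of covers that
  \<open>basic_block\<close> speaks of.\<close>

lemma (in fin_poset) irreducible_doubly_irreducible:
  assumes lat: "finite_lattice V le" and x: "x \<in> V" "\<not> reducible V le x"
  shows "doubly_irreducible V le x"
proof -
  have fin: "finite {z. covers V le z x}" "finite {z. covers V le x z}"
    by (rule finite_subset[OF _ finite_carrier], auto simp: covers_def)+
  have "\<exists>z. is_glb V le x y z" "\<exists>z. is_lub V le x y z" if "x \<in> V" "y \<in> V" for x y
    using lat that by (auto simp: finite_lattice_def)
  then show ?thesis
    unfolding doubly_irreducible_def One_nat_def card_le_Suc0_iff_eq[OF fin(1)] card_le_Suc0_iff_eq[OF fin(2)]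
    using upper_covers_unique[OF _ x(2)] lower_covers_unique[OF _ x(2)] x(1) by blast
qed

text \<open>If the lower cover p of x were irreducible, x would be its only upper cover and no
  second element could lie strictly between p and the upper cover of x.\<close>

lemma (in fin_poset) irreducible_covers:
  assumes lat: "finite_lattice V le" and bb: "basic_block V le" and card: "2 \<le> card V"
    and x: "x \<in> V" "\<not> reducible V le x"
  shows "\<exists>p q. reducible V le p \<and> reducible V le q \<and>
           {z. covers V le z x} = {p} \<and> {z. covers V le x z} = {q}"
proof -
  have glb: "\<exists>z. is_glb V le x y z" and lub: "\<exists>z. is_lub V le x y z" if "x \<in> V" "y \<in> V" for x y
    using lat that by (auto simp: finite_lattice_def)
  have ne: "V \<noteq> {}" using lat by (simp add: finite_lattice_def)
  obtain m where m: "m \<in> V" "\<And>x. x \<in> V \<Longrightarrow> le m x" using exists_bottom[OF ne glb] by blast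
  \<comment> \<open>At least two elements, one of them doubly irreducible, exclude the first two
    alternatives of \<open>basic_block\<close>.\<close>
  have drop: "nullity (V - {y}) le = nullity V le - 1" if "doubly_irreducible V le y" for y
    using bb card that unfolding basic_block_def doubly_irreducible_def by auto
  note di = irreducible_doubly_irreducible[OF lat]
  obtain p q y where pq: "{z. covers V le z x} = {p}" "{z. covers V le x z} = {q}"
    and y: "y \<in> V" "le p y" "le y q" "y \<noteq> p" "y \<noteq> q" "y \<noteq> x"
    using nullity_drop_covers[OF m di[OF x] card drop[OF di[OF x]]] by blast
  have px: "covers V le p x" and qx: "covers V le x q" using pq by auto
  then have V: "p \<in> V" "q \<in> V" by (auto simp: covers_def)
  have "reducible V le p"
  proof (rule ccontr)
    assume irr: "\<not> reducible V le p"
    obtain z where "covers V le p z" "le z y" using exists_upper_cover[of p y] V y by blast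
    then have "le x y" using upper_covers_unique[OF glb irr _ px] by blast
    then show False using qx y unfolding covers_def by blast
  qed
  moreover have "reducible V le q"
  proof (rule ccontr)
    assume irr: "\<not> reducible V le q"
    obtain z where "covers V le z q" "le y z" using exists_lower_cover[of y q] V y by blast
    then have "le y x" using lower_covers_unique[OF lub irr _ qx] by blast
    then show False using px y unfolding covers_def by blast
  qed
  ultimately show ?thesis using pq by blast
qed

section \<open>Adjunct pairs and their indices\<close>

definition index_pairs :: "nat \<Rightarrow> (nat \<times> nat) set" where
  "index_pairs n = {(i, j). 1 \<le> i \<and> i < j \<and> j \<le> n}"

lemma finite_index_pairs: "finite (index_pairs n)"
  by (rule finite_subset[of _ "{1..n} \<times> {1..n}"]) (auto simp: index_pairs_def)

lemma card_index_pairs: "card (index_pairs n) = n choose 2"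
proof (induction n)
  case 0
  have "index_pairs 0 = {}" by (auto simp: index_pairs_def)
  then show ?case by simp
next
  case (Suc n)
  have "index_pairs (Suc n) = index_pairs n \<union> (\<lambda>i. (i, Suc n)) ` {1..n}"
    by (auto simp: index_pairs_def le_Suc_eq)
  moreover have "index_pairs n \<inter> (\<lambda>i. (i, Suc n)) ` {1..n} = {}"
    by (auto simp: index_pairs_def)
  moreover have "card ((\<lambda>i. (i, Suc n)) ` {1..n}) = n"
    by (subst card_image) (auto simp: inj_on_def)
  ultimately show ?case using Suc finite_index_pairs
    by (simp add: card_Un_disjoint numeral_2_eq_2)
qed

lemma card_consecutive_index_pairs: "card {(i, j) \<in> index_pairs n. j = Suc i} = n - 1"
proof -
  have "{(i, j) \<in> index_pairs n. j = Suc i} = (\<lambda>i. (i, Suc i)) ` {1..<n}"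
    by (auto simp: index_pairs_def)
  then show ?thesis by (simp add: card_image inj_on_def)
qed

text \<open>Ensures that the natural-number subtraction in \<open>pair_index\<close> does not
  truncate.\<close>

lemma choose_two_bound:
  assumes "1 \<le> i" "i \<le> n" shows "i choose 2 \<le> (i - 1) * n"
proof -
  have "i choose 2 \<le> i * (i - 1)" by (simp add: choose_two)
  also have "\<dots> \<le> (i - 1) * n" using assms by (simp add: mult.commute)
  finally show ?thesis .
qed

text \<open>The numbering runs row by row: row \<open>i\<close> fills the \<open>n - i\<close>
  values after \<open>(i - 1) * n - (i choose 2)\<close>, and by Pascal's rule the next row starts
  where it ends.\<close>

lemma pair_index_less:
  assumes "(i, j) \<in> index_pairs n" "(i', j') \<in> index_pairs n" "i < i'"
  shows "pair_index n i j < pair_index n i' j'"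
proof -
  have step: "(i - 1) * n - (i choose 2) + (n - i) = i * n - (Suc i choose 2)"
    if i: "1 \<le> i" "i < n" for i
  proof -
    obtain m where m: "i = Suc m" using i by (cases i) auto
    have "Suc i choose 2 = (i choose 2) + i" by (simp add: numeral_2_eq_2)
    moreover have "i * n = (i - 1) * n + n" using m by simp
    moreover note choose_two_bound[of i n] i
    ultimately show ?thesis by linarith
  qed
  define b where "b k = (k - 1) * n - (k choose 2)" for k
  have mono: "b i + (n - i) \<le> b k" if "i < k" "k \<le> n" for k
    using that
  proof (induction k)
    case (Suc k)
    have bS: "b (Suc k) = b k + (n - k)" if "1 \<le> k" using step[of k] Suc.prems that by (simp add: b_def)
    show ?case
    proof (cases "i = k")
      case True
      then show ?thesis using bS assms(1) by (auto simp: index_pairs_def)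
    next
      case False
      then have "b i + (n - i) \<le> b k" "1 \<le> k" using Suc by auto
      then show ?thesis using bS by simp
    qed
  qed simp
  have "pair_index n i j \<le> b i + (n - i)" using assms(1)
    by (auto simp: pair_index_def b_def index_pairs_def)
  also have "\<dots> \<le> b i'" using mono assms by (auto simp: index_pairs_def)
  also have "\<dots> < pair_index n i' j'" using assms(2)
    by (auto simp: pair_index_def b_def index_pairs_def)
  finally show ?thesis .
qed

text \<open>Allows the family \<open>c\<close> to be defined by inverting the numbering.\<close>

lemma inj_on_pair_index: "inj_on (\<lambda>(i, j). pair_index n i j) (index_pairs n)"
proof (rule inj_onI, clarify)
  fix i j i' j'
  assume p: "(i, j) \<in> index_pairs n" "(i', j') \<in> index_pairs n"
    and eq: "pair_index n i j = pair_index n i' j'"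
  have "i = i'" using pair_index_less[OF p] pair_index_less[OF p(2,1)] eq by (metis less_irrefl nat_neq_iff)
  moreover from this have "j = j'" using eq p by (auto simp: pair_index_def index_pairs_def)
  ultimately show "i = i' \<and> j = j'" by blast
qed

section \<open>Chains as lists, and adjoining singletons\<close>

lemma chain_le_sorted:
  assumes "fin_poset V le" "sorted_wrt (\<lambda>x y. le x y \<and> x \<noteq> y) C" "set C \<subseteq> V" "x \<in> set C" "y \<in> set C"
  shows "chain_le C x y = le x y"
proof
  interpret fin_poset V le by fact
  assume "chain_le C x y"
  then obtain i j where ij: "i \<le> j" "j < length C" "C ! i = x" "C ! j = y" by (auto simp: chain_le_def)
  show "le x y"
  proof (cases "i = j")
    case True
    then show ?thesis using ij assms le_refl by auto
  next
    case False
    then show ?thesis using sorted_wrt_nth_less[OF assms(2), of i j] ij by auto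
  qed
next
  interpret fin_poset V le by fact
  assume le: "le x y"
  obtain i j where ij: "i < length C" "j < length C" "C ! i = x" "C ! j = y"
    using assms by (auto simp: in_set_conv_nth)
  have "i \<le> j"
  proof (rule ccontr)
    assume "\<not> i \<le> j"
    then have "le y x" "y \<noteq> x" using sorted_wrt_nth_less[OF assms(2), of j i] ij by auto
    then show False using le le_antisym assms by blast
  qed
  then show "chain_le C x y" using ij unfolding chain_le_def by blast
qed

lemma sorted_wrt_strict_distinct: "sorted_wrt (\<lambda>x y. le x y \<and> x \<noteq> y) C \<Longrightarrow> distinct C"
  by (induction C) auto

lemma CF_chain_Suc: "1 \<le> m \<Longrightarrow> CF_chain (Suc m) u x = CF_chain m u x @ [x m, u (Suc m)]"
  by (simp add: CF_chain_def)

lemma set_CF_chain: "1 \<le> n \<Longrightarrow> set (CF_chain n u x) = u ` {1..n} \<union> x ` {1..<n}"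
proof (induction n rule: dec_induct)
  case base
  then show ?case by (simp add: CF_chain_def)
next
  case (step m)
  then show ?case
    by (auto simp: CF_chain_Suc atLeastAtMostSuc_conv atLeastLessThanSuc)
qed

text \<open>Agreement of \<open>R\<close> with \<open>le\<close> is asked on \<open>W\<close> only,
  since each step changes the relation elsewhere. The hypotheses persist when \<open>W\<close> grows
  by \<open>c\<close>: pairs and intermediate elements stay in the carrier, and distinctness keeps
  later singletons outside.\<close>

lemma adjoin_singletons:
  fixes ts :: "('a \<times> 'a \<times> 'a) list"
  assumes "W \<subseteq> V"
    and "\<And>x y. x \<in> W \<Longrightarrow> y \<in> W \<Longrightarrow> R x y = le x y"
    and "\<And>x. x \<in> V \<Longrightarrow> le x x"
    and "distinct (map (\<lambda>(a, b, c). c) ts)"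
    and "\<And>a b c. (a, b, c) \<in> set ts \<Longrightarrow> a \<in> W \<and> b \<in> W \<and> c \<in> V - W \<and> a \<noteq> b \<and> le a b \<and>
           (\<exists>z\<in>W. le a z \<and> le z b \<and> z \<noteq> a \<and> z \<noteq> b)"
    and "\<And>a b c w. (a, b, c) \<in> set ts \<Longrightarrow> w \<in> V \<Longrightarrow> w \<noteq> c \<Longrightarrow>
           (le w c \<longleftrightarrow> le w a) \<and> (le c w \<longleftrightarrow> le b w)"
  shows "adj_valid (W, R) (map (\<lambda>(a, b, c). (a, b, [c])) ts) \<and>
         fst (adj_iter (W, R) (map (\<lambda>(a, b, c). (a, b, [c])) ts)) = W \<union> (\<lambda>(a, b, c). c) ` set ts \<and>
         (\<forall>x \<in> W \<union> (\<lambda>(a, b, c). c) ` set ts. \<forall>y \<in> W \<union> (\<lambda>(a, b, c). c) ` set ts.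
            snd (adj_iter (W, R) (map (\<lambda>(a, b, c). (a, b, [c])) ts)) x y = le x y)"
  using assms
proof (induction ts arbitrary: W R)
  case Nil
  then show ?case by simp
next
  case (Cons t ts)
  obtain a b c where t: "t = (a, b, c)" by (cases t)
  have abc: "a \<in> W" "b \<in> W" "c \<in> V" "c \<notin> W" "a \<noteq> b" "le a b"
    "\<exists>z\<in>W. le a z \<and> le z b \<and> z \<noteq> a \<and> z \<noteq> b"
    using Cons.prems(5)[of a b c] t by auto
  have c: "le w c \<longleftrightarrow> le w a" "le c w \<longleftrightarrow> le b w" if "w \<in> V" "w \<noteq> c" for w
    using Cons.prems(6)[of a b c w] that t by auto
  obtain R' where adj: "adjunct (W, R) a b [c] = (insert c W, R')" by (simp add: adjunct_def)
  have cc: "chain_le [c] c c" by (auto simp: chain_le_def)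
  have R': "R' = (\<lambda>x y. x \<in> W \<and> y \<in> W \<and> R x y \<or> x = c \<and> y = c \<and> chain_le [c] x y \<or>
      x \<in> W \<and> y = c \<and> R x a \<or> x = c \<and> y \<in> W \<and> R b y)"
    using adj by (auto simp: adjunct_def)
  have R: "R' x y = le x y" if xy: "x \<in> insert c W" "y \<in> insert c W" for x y
  proof -
    have le_cc: "le c c" using Cons.prems(3) abc by blast
    have W: "w \<in> V \<and> w \<noteq> c" if "w \<in> W" for w using that Cons.prems(1) abc by blast
    consider "x \<in> W" "y \<in> W" | "x \<in> W" "y = c" | "x = c" "y \<in> W" | "x = c" "y = c"
      using xy by blast
    then show ?thesis
    proof cases
      case 1
      then show ?thesis using Cons.prems(2) W unfolding R' by blast
    next
      case 2
      then show ?thesis using Cons.prems(2)[of x a] W c abc unfolding R' by blast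
    next
      case 3
      then show ?thesis using Cons.prems(2)[of b y] W c abc unfolding R' by blast
    next
      case 4
      then show ?thesis using le_cc cc unfolding R' by blast
    qed
  qed
  have ncov: "\<not> covers W R a b"
    using abc Cons.prems(2) unfolding covers_def by blast
  have IH: "adj_valid (insert c W, R') (map (\<lambda>(a, b, c). (a, b, [c])) ts) \<and>
         fst (adj_iter (insert c W, R') (map (\<lambda>(a, b, c). (a, b, [c])) ts)) = insert c W \<union> (\<lambda>(a, b, c). c) ` set ts \<and>
         (\<forall>x \<in> insert c W \<union> (\<lambda>(a, b, c). c) ` set ts. \<forall>y \<in> insert c W \<union> (\<lambda>(a, b, c). c) ` set ts.
            snd (adj_iter (insert c W, R') (map (\<lambda>(a, b, c). (a, b, [c])) ts)) x y = le x y)"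
  proof (rule Cons.IH)
    show "insert c W \<subseteq> V" using Cons.prems(1) abc by blast
    show "distinct (map (\<lambda>(a, b, c). c) ts)" using Cons.prems(4) by simp
    fix a' b' c'
    assume t': "(a', b', c') \<in> set ts"
    have "c' \<noteq> c" using Cons.prems(4) t' by (force simp: t)
    then show "a' \<in> insert c W \<and> b' \<in> insert c W \<and> c' \<in> V - insert c W \<and> a' \<noteq> b' \<and> le a' b' \<and>
           (\<exists>z\<in>insert c W. le a' z \<and> le z b' \<and> z \<noteq> a' \<and> z \<noteq> b')"
      using Cons.prems(5)[of a' b' c'] t' by auto
    show "(le w c' \<longleftrightarrow> le w a') \<and> (le c' w \<longleftrightarrow> le b' w)" if "w \<in> V" "w \<noteq> c'" for w
      using Cons.prems(6)[of a' b' c' w] t' that by auto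
  qed (use R Cons.prems(3) in auto)
  have "R a b" using Cons.prems(2) abc by blast
  then show ?case using IH abc ncov by (simp add: t adj)
qed

text \<open>Brings the steps into the shape of \<open>adjoin_singletons\<close>, with the list of
  index pairs isolated.\<close>

lemma CF_steps_eq_map:
  "CF_steps n u c = map (\<lambda>(a, b, c). (a, b, [c])) (map (\<lambda>(i, j). (u i, u j, c (pair_index n i j)))
     (concat (map (\<lambda>i. map (Pair i) [Suc i..<Suc n]) [1..<n])))"
  by (simp add: CF_steps_def map_concat comp_def)

lemma set_pair_list:
  "set (concat (map (\<lambda>i. map (Pair i) [Suc i..<Suc n]) [1..<n])) = index_pairs n"
  by (force simp: index_pairs_def simp del: upt_Suc)

lemma distinct_pair_list:
  "distinct (concat (map (\<lambda>i. map (Pair i) [Suc i..<Suc n]) [1..<n]))"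
proof (rule distinct_concat)
  have "i = j" if "i \<in> {1..<n}" "j \<in> {1..<n}"
    and eq: "map (Pair i) [Suc i..<Suc n] = map (Pair j) [Suc j..<Suc n]" for i j
  proof -
    \<comment> \<open>Row \<open>i\<close> is nonempty because \<open>i < n\<close>; any entry
      reveals its row.\<close>
    have "(i, n) \<in> set (map (Pair j) [Suc j..<Suc n])"
      unfolding eq[symmetric] using that by auto
    then show ?thesis by auto
  qed
  then show "distinct (map (\<lambda>i. map (Pair i) [Suc i..<Suc n]) [1..<n])"
    by (simp add: distinct_map inj_on_def del: upt_Suc)
qed (auto simp: distinct_map inj_on_def simp del: upt_Suc)

section \<open>Blocks of maximal nullity\<close>

text \<open>Collects what the count uses. The adjunct representation enters only through the bounds
  \<open>links_le_2\<close> and \<open>links_le_1\<close>, and the basic block property only through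
  \<open>irr_covers\<close>.\<close>

locale complete_block = fin_poset +
  fixes n :: nat and u :: "nat \<Rightarrow> 'a"
  assumes n_ge: "2 \<le> n"
    and red: "reducibles V le = u ` {1..n}"
    and u_less: "\<And>i j. 1 \<le> i \<Longrightarrow> i < j \<Longrightarrow> j \<le> n \<Longrightarrow> le (u i) (u j) \<and> u i \<noteq> u j"
    and irr_covers: "\<And>x. x \<in> V \<Longrightarrow> \<not> reducible V le x \<Longrightarrow>
      \<exists>p q. reducible V le p \<and> reducible V le q \<and>
           {z. covers V le z x} = {p} \<and> {z. covers V le x z} = {q}"
    and links_le_2: "\<And>p q. card (links V le p q) \<le> 2"
    and links_le_1: "\<And>p q r. r \<in> V \<Longrightarrow> reducible V le r \<Longrightarrow> le p r \<Longrightarrow> le r q \<Longrightarrow> r \<noteq> p \<Longrightarrow> r \<noteq> q \<Longrightarrow>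
      card (links V le p q) \<le> 1"
    and nullity_eq: "nullity V le = int (n choose 2)"
    and connected: "num_components V le = 1"
begin

abbreviation D :: "nat \<Rightarrow> nat \<Rightarrow> 'a set" where "D i j \<equiv> links V le (u i) (u j)"

lemma u_red: "1 \<le> i \<Longrightarrow> i \<le> n \<Longrightarrow> u i \<in> V \<and> reducible V le (u i)"
proof -
  assume "1 \<le> i" "i \<le> n"
  then have "u i \<in> reducibles V le" unfolding red by simp
  then show ?thesis by (simp add: reducibles_def)
qed

lemma red_ex: "x \<in> V \<Longrightarrow> reducible V le x \<Longrightarrow> \<exists>i. 1 \<le> i \<and> i \<le> n \<and> x = u i"
proof -
  assume "x \<in> V" "reducible V le x"
  then have "x \<in> u ` {1..n}" unfolding red[symmetric] by (simp add: reducibles_def)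
  then show ?thesis by auto
qed

lemma u_inj: "1 \<le> i \<Longrightarrow> i \<le> n \<Longrightarrow> 1 \<le> j \<Longrightarrow> j \<le> n \<Longrightarrow> u i = u j \<Longrightarrow> i = j"
  using u_less[of i j] u_less[of j i] by (cases i j rule: linorder_cases) auto

lemma u_le: "1 \<le> i \<Longrightarrow> i \<le> j \<Longrightarrow> j \<le> n \<Longrightarrow> le (u i) (u j)"
  using u_less[of i j] u_red[of i] le_refl by (cases "i = j") auto

lemma u_lt_index:
  assumes "1 \<le> i" "i \<le> n" "1 \<le> j" "j \<le> n" "le (u i) (u j)" "u i \<noteq> u j"
  shows "i < j"
proof (rule ccontr)
  assume "\<not> i < j"
  then have "le (u j) (u i)" using u_le assms by auto
  then show False using le_antisym assms u_red by blast
qed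

lemma linksD:
  assumes "x \<in> links V le p q"
  shows "x \<in> V" "\<not> reducible V le x" "covers V le p x" "covers V le x q" "p \<in> V" "q \<in> V"
    "le p x" "le x q" "p \<noteq> x" "x \<noteq> q"
  using assms by (auto simp: links_def covers_def)

lemma links_unique:
  assumes "x \<in> links V le p q"
  shows "covers V le z x \<longleftrightarrow> z = p" "covers V le x z \<longleftrightarrow> z = q"
proof -
  obtain p' q' where pq: "{z. covers V le z x} = {p'}" "{z. covers V le x z} = {q'}"
    using irr_covers linksD(1,2)[OF assms] by blast
  then show "covers V le z x \<longleftrightarrow> z = p" "covers V le x z \<longleftrightarrow> z = q"
    using linksD(3,4)[OF assms] by (auto simp: set_eq_iff)
qed

text \<open>The two covers of \<open>x\<close> are reducible by \<open>irr_covers\<close>, hence are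
  some \<open>u i\<close> and \<open>u j\<close>.\<close>

lemma irr_in_D:
  assumes x: "x \<in> V" "\<not> reducible V le x"
  shows "\<exists>i j. (i, j) \<in> index_pairs n \<and> x \<in> D i j"
proof -
  obtain p q where pq: "reducible V le p" "reducible V le q" "covers V le p x" "covers V le x q"
    using irr_covers[OF x] by blast
  then have "p \<in> V" "q \<in> V" by (auto simp: covers_def)
  then obtain i j where ij: "1 \<le> i" "i \<le> n" "p = u i" "1 \<le> j" "j \<le> n" "q = u j"
    using red_ex pq by metis
  have xD: "x \<in> D i j" using x pq ij by (simp add: links_def)
  note X = linksD[OF xD]
  have "le (u i) (u j)" using X le_trans[of "u i" x "u j"] by blast
  moreover have "u i \<noteq> u j" using X le_antisym[of "u i" x] by metis
  ultimately have "i < j" using u_lt_index[of i j] ij by blast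
  then show ?thesis using xD ij by (auto simp: index_pairs_def)
qed

lemma D_index_unique:
  assumes "x \<in> D i j" "x \<in> D i' j'" "(i, j) \<in> index_pairs n" "(i', j') \<in> index_pairs n"
  shows "i = i' \<and> j = j'"
proof -
  have "u i = u i'" "u j = u j'"
    using links_unique[OF assms(1)] linksD(3,4)[OF assms(2)] by auto
  then show ?thesis using u_inj assms(3,4) by (auto simp: index_pairs_def)
qed

text \<open>A single lower and a single upper cover act as gates. This is the condition under which
  \<open>adjoin_singletons\<close> adjoins \<open>x\<close> at \<open>(p, q)\<close>.\<close>

lemma le_link_iff:
  assumes x: "x \<in> links V le p q" and w: "w \<in> V" "w \<noteq> x"
  shows "le w x \<longleftrightarrow> le w p" "le x w \<longleftrightarrow> le q w"
proof -
  note X = linksD[OF x]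
  show "le w x \<longleftrightarrow> le w p"
    using exists_lower_cover[of w x] links_unique(1)[OF x] le_trans[of w p x] X w by metis
  show "le x w \<longleftrightarrow> le q w"
    using exists_upper_cover[of x w] links_unique(2)[OF x] le_trans[of x q w] X w by metis
qed

section \<open>Counting elements and coverings\<close>

definition irr :: "'a set" where "irr = {x \<in> V. \<not> reducible V le x}"

text \<open>In the overview, \<open>t\<close> is the size of this set and \<open>m\<close> that of
  \<open>irr\<close>. The count will show that this set is empty.\<close>

definition consec :: "(nat \<times> nat) set" where
  "consec = {(i, j) \<in> index_pairs n. covers V le (u i) (u j)}"

lemma finite_irr: "finite irr"
  using finite_carrier by (simp add: irr_def)

lemma finite_D: "finite (D i j)"
  using finite_carrier by (simp add: links_def)

lemma card_irr: "card irr = (\<Sum>(i, j)\<in>index_pairs n. card (D i j))"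
proof -
  have "irr = (\<Union>p\<in>index_pairs n. D (fst p) (snd p))"
    using irr_in_D unfolding irr_def links_def by fastforce
  moreover have "card (\<Union>p\<in>index_pairs n. D (fst p) (snd p)) = (\<Sum>p\<in>index_pairs n. card (D (fst p) (snd p)))"
  proof (rule card_UN_disjoint)
    show "\<forall>p\<in>index_pairs n. \<forall>q\<in>index_pairs n. p \<noteq> q \<longrightarrow> D (fst p) (snd p) \<inter> D (fst q) (snd q) = {}"
    proof (intro ballI impI)
      fix p q assume pq: "p \<in> index_pairs n" "q \<in> index_pairs n" "p \<noteq> q"
      show "D (fst p) (snd p) \<inter> D (fst q) (snd q) = {}"
        using D_index_unique[of _ "fst p" "snd p" "fst q" "snd q"] pq
        by (auto simp: prod_eq_iff)
    qed
  qed (use finite_index_pairs finite_D in auto)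
  ultimately show ?thesis by (simp add: case_prod_beta)
qed

lemma card_carrier: "card V = n + card irr"
proof -
  have "V = u ` {1..n} \<union> irr" "u ` {1..n} \<inter> irr = {}"
    unfolding red[symmetric] by (auto simp: irr_def reducibles_def)
  moreover have "card (u ` {1..n}) = n"
    by (subst card_image) (auto intro!: inj_onI u_inj)
  ultimately show ?thesis using finite_irr by (metis card_Un_disjoint finite_atLeastAtMost finite_imageI)
qed

text \<open>Each irreducible element is the top of one covering and the bottom of one. These are all
  different because its covers are reducible; the remaining coverings join two reducible
  elements.\<close>

lemma card_coverings: "card (coverings V le) = 2 * card irr + card consec"
proof -
  let ?X = "{(a, b) \<in> coverings V le. b \<in> irr}"
  let ?Y = "{(a, b) \<in> coverings V le. a \<in> irr}"
  let ?Z = "(\<lambda>(i, j). (u i, u j)) ` consec"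
  have irrD: "\<exists>i j. (i, j) \<in> index_pairs n \<and> x \<in> D i j" if "x \<in> irr" for x
    using irr_in_D that by (auto simp: irr_def)
  have X: "card ?X = card irr"
  proof -
    have "bij_betw snd ?X irr"
      unfolding bij_betw_def
    proof
      show "inj_on snd ?X"
      proof (rule inj_onI, clarify)
        fix a b a' b' assume "(a, b) \<in> coverings V le" "(a', b') \<in> coverings V le" "b' \<in> irr" "snd (a, b) = snd (a', b')"
        then show "a = a' \<and> b = b'"
          using irrD[of b'] links_unique(1)[of b'] by (auto simp: coverings_def)
      qed
      show "snd ` ?X = irr"
      proof
        show "irr \<subseteq> snd ` ?X"
        proof
          fix x assume x: "x \<in> irr"
          then obtain i j where "x \<in> D i j" using irrD by blast
          then have "(u i, x) \<in> ?X" using x linksD(3) by (auto simp: coverings_def)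
          then show "x \<in> snd ` ?X" by force
        qed
      qed auto
    qed
    then show ?thesis by (rule bij_betw_same_card)
  qed
  have Y: "card ?Y = card irr"
  proof -
    have "bij_betw fst ?Y irr"
      unfolding bij_betw_def
    proof
      show "inj_on fst ?Y"
      proof (rule inj_onI, clarify)
        fix a b a' b' assume "(a, b) \<in> coverings V le" "(a', b') \<in> coverings V le" "a' \<in> irr" "fst (a, b) = fst (a', b')"
        then show "a = a' \<and> b = b'"
          using irrD[of a'] links_unique(2)[of a'] by (auto simp: coverings_def)
      qed
      show "fst ` ?Y = irr"
      proof
        show "irr \<subseteq> fst ` ?Y"
        proof
          fix x assume x: "x \<in> irr"
          then obtain i j where "x \<in> D i j" using irrD by blast
          then have "(x, u j) \<in> ?Y" using x linksD(4) by (auto simp: coverings_def)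
          then show "x \<in> fst ` ?Y" by force
        qed
      qed auto
    qed
    then show ?thesis by (rule bij_betw_same_card)
  qed
  have "inj_on (\<lambda>(i, j). (u i, u j)) consec"
    by (rule inj_onI) (auto simp: consec_def index_pairs_def intro: u_inj)
  then have Z: "card ?Z = card consec" by (rule card_image)
  have sub: "?X \<subseteq> coverings V le" "?Y \<subseteq> coverings V le" by auto
  then have fin: "finite ?X" "finite ?Y" using finite_coverings finite_subset by blast+
  have finZ: "finite ?Z"
    by (rule finite_imageI, rule finite_subset[OF _ finite_index_pairs[of n]]) (auto simp: consec_def)
  have XY: "?X \<inter> ?Y = {}"
  proof -
    have False if "covers V le a b" "a \<in> irr" "b \<in> irr" for a b
    proof -
      obtain i j where ij: "(i, j) \<in> index_pairs n" "b \<in> D i j" using irrD \<open>b \<in> irr\<close> by blast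
      then have "a = u i" using links_unique(1) that by blast
      then show False using u_red[of i] ij that by (auto simp: irr_def index_pairs_def)
    qed
    then show ?thesis by (auto simp: coverings_def)
  qed
  have Z_red: "u i \<notin> irr \<and> u j \<notin> irr" if "(i, j) \<in> consec" for i j
    using u_red[of i] u_red[of j] that by (auto simp: irr_def consec_def index_pairs_def)
  then have XYZ: "(?X \<union> ?Y) \<inter> ?Z = {}" by auto
  have "coverings V le = ?X \<union> ?Y \<union> ?Z"
  proof (intro equalityI subsetI)
    fix e assume e: "e \<in> coverings V le"
    obtain a b where ab: "e = (a, b)" by (cases e)
    have c: "covers V le a b" "a \<in> V" "b \<in> V" "le a b" "a \<noteq> b" using e ab by (auto simp: coverings_def covers_def)
    show "e \<in> ?X \<union> ?Y \<union> ?Z"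
    proof (cases "a \<in> irr \<or> b \<in> irr")
      case True
      then show ?thesis using e ab by auto
    next
      case False
      then obtain i j where ij: "1 \<le> i" "i \<le> n" "a = u i" "1 \<le> j" "j \<le> n" "b = u j"
        using red_ex c by (metis (mono_tags, lifting) irr_def mem_Collect_eq)
      then have "(i, j) \<in> consec" using u_lt_index[of i j] c by (auto simp: consec_def index_pairs_def)
      then show ?thesis using ab ij by force
    qed
  next
    fix e assume "e \<in> ?X \<union> ?Y \<union> ?Z"
    then show "e \<in> coverings V le" by (auto simp: consec_def coverings_def)
  qed
  then have "card (coverings V le) = card (?X \<union> ?Y) + card ?Z"
    using card_Un_disjoint[OF _ finZ XYZ] fin by simp
  then show ?thesis using card_Un_disjoint[OF fin XY] X Y Z by simp
qed

lemma irr_consec: "card irr + card consec = (n choose 2) + (n - 1)"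
proof -
  have "int (card (coverings V le)) - int (card V) + 1 = int (n choose 2)"
    using nullity_eq connected unfolding nullity_def card_cover_edges by simp
  then show ?thesis using card_coverings card_carrier n_ge by linarith
qed

text \<open>Counting a covering \<open>(u i, u j)\<close> together with the links of that pair keeps
  the bound of 2 or 1 valid, since such a covering excludes links. The sums of both sides agree by
  \<open>irr_consec\<close>, so every bound is attained.\<close>

lemma card_D:
  assumes ij: "(i, j) \<in> index_pairs n"
  shows "card (D i j) = (if j = Suc i then 2 else 1)" "(i, j) \<notin> consec"
proof -
  let ?f = "\<lambda>(i, j). card (D i j) + (if (i, j) \<in> consec then 1 else 0)"
  let ?g = "\<lambda>(i, j). 1 + (if j = Suc i then 1 else 0 :: nat)"
  have empty: "D i j = {}" if "(i, j) \<in> consec" for i j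
    using that unfolding consec_def links_def covers_def by blast
  have le: "?f p \<le> ?g p" if p: "p \<in> index_pairs n" for p
  proof -
    obtain i j where ij: "p = (i, j)" "1 \<le> i" "i < j" "j \<le> n"
      using p by (auto simp: index_pairs_def)
    show ?thesis
    proof (cases "j = Suc i")
      case True
      then show ?thesis using links_le_2[of "u i" "u j"] empty[of i j] ij by auto
    next
      case False
      \<comment> \<open>For indices further apart, \<open>u (Suc i)\<close> lies strictly between
        and brings the sharper bound.\<close>
      have r: "u (Suc i) \<in> V" "reducible V le (u (Suc i))" "le (u i) (u (Suc i))" "le (u (Suc i)) (u j)"
        "u (Suc i) \<noteq> u i" "u (Suc i) \<noteq> u j"
        using u_red[of "Suc i"] u_less[of i "Suc i"] u_less[of "Suc i" j] ij False by auto
      then have "(i, j) \<notin> consec" unfolding consec_def covers_def by blast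
      then show ?thesis using links_le_1[OF r] False ij by auto
    qed
  qed
  have "sum ?f (index_pairs n) = card irr + card consec"
  proof -
    have "(\<Sum>(i, j)\<in>index_pairs n. if (i, j) \<in> consec then 1 else 0 :: nat) = card (index_pairs n \<inter> consec)"
      using finite_index_pairs by (simp add: sum.If_cases case_prod_beta Int_def)
    moreover have "index_pairs n \<inter> consec = consec" by (auto simp: consec_def)
    ultimately show ?thesis using card_irr by (simp add: sum.distrib case_prod_beta)
  qed
  moreover have "sum ?g (index_pairs n) = (n choose 2) + (n - 1)"
  proof -
    have "(\<Sum>(i, j)\<in>index_pairs n. if j = Suc i then 1 else 0 :: nat) = card {(i, j) \<in> index_pairs n. j = Suc i}"
      using finite_index_pairs by (simp add: sum.If_cases case_prod_beta Int_def) (rule arg_cong[where f = card], auto)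
    then show ?thesis using card_consecutive_index_pairs card_index_pairs
      by (simp add: sum_Suc case_prod_beta)
  qed
  ultimately have "sum ?f (index_pairs n) = sum ?g (index_pairs n)" using irr_consec by simp
  \<comment> \<open>Termwise inequality with equal sums forces equality in each term.\<close>
  from sum_mono_inv[OF this le ij finite_index_pairs]
  have eq: "card (D i j) + (if (i, j) \<in> consec then 1 else 0) = 1 + (if j = Suc i then 1 else 0)" by simp
  show nc: "(i, j) \<notin> consec"
  proof
    assume c: "(i, j) \<in> consec"
    then have "D i j = {}" by (rule empty)
    \<comment> \<open>An empty \<open>D i j\<close> makes the left side 1, whereas neighbouring
      indices require 2.\<close>
    then have "j \<noteq> Suc i" using eq c by auto
    then have "le (u i) (u (Suc i)) \<and> u i \<noteq> u (Suc i) \<and> le (u (Suc i)) (u j) \<and> u (Suc i) \<noteq> u j \<and> u (Suc i) \<in> V"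
      using u_red[of "Suc i"] u_less[of i "Suc i"] u_less[of "Suc i" j] ij by (auto simp: index_pairs_def)
    then show False using c unfolding consec_def covers_def by auto
  qed
  show "card (D i j) = (if j = Suc i then 2 else 1)" using eq nc by simp
qed

lemma consec_empty: "consec = {}"
  using card_D(2) by (auto simp: consec_def)

lemma card_irr_eq: "card irr = (n choose 2) + (n - 1)"
  using irr_consec consec_empty by simp

section \<open>Building the representation\<close>

text \<open>Splits the irreducible elements: the \<open>x i\<close> will go into the base chain, the
  \<open>d i j\<close> become adjoined singletons.\<close>

lemma representatives:
  "\<exists>x d. (\<forall>i\<in>{1..<n}. x i \<in> D i (Suc i) \<and> x i \<noteq> d i (Suc i)) \<and>
     (\<forall>i j. (i, j) \<in> index_pairs n \<longrightarrow> d i j \<in> D i j) \<and>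
     irr \<subseteq> x ` {1..<n} \<union> (\<lambda>(i, j). d i j) ` index_pairs n"
proof -
  have "\<exists>y d. D i j = (if j = Suc i then {y, d} else {d}) \<and> y \<noteq> d" if "(i, j) \<in> index_pairs n" for i j
  proof (cases "j = Suc i")
    case True
    then have "card (D i j) = 2" using card_D(1) that by simp
    then show ?thesis using True by (auto simp: card_2_iff)
  next
    case False
    then have "card (D i j) = 1" using card_D(1) that by simp
    then obtain d where d: "D i j = {d}" by (auto simp: card_1_singleton_iff)
    \<comment> \<open>Here \<open>y\<close> is a mere placeholder, and \<open>u i\<close> serves as
      a value different from \<open>d\<close>.\<close>
    have "u i \<noteq> d" using linksD(9)[of d "u i" "u j"] d by simp
    then show ?thesis using False d by auto
  qed
  then obtain y d where yd: "\<And>i j. (i, j) \<in> index_pairs n \<Longrightarrow>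
      D i j = (if j = Suc i then {y i j, d i j} else {d i j}) \<and> y i j \<noteq> d i j" by metis
  have "irr \<subseteq> (\<lambda>i. y i (Suc i)) ` {1..<n} \<union> (\<lambda>(i, j). d i j) ` index_pairs n"
  proof
    fix v assume "v \<in> irr"
    then obtain i j where ij: "(i, j) \<in> index_pairs n" "v \<in> D i j" using irr_in_D unfolding irr_def by blast
    then have "v = d i j \<or> j = Suc i \<and> v = y i (Suc i)" using yd[OF ij(1)] by (auto split: if_splits)
    moreover have "j = Suc i \<Longrightarrow> i \<in> {1..<n}" using ij by (auto simp: index_pairs_def)
    ultimately show "v \<in> (\<lambda>i. y i (Suc i)) ` {1..<n} \<union> (\<lambda>(i, j). d i j) ` index_pairs n"
      using ij(1) by force
  qed
  moreover have "\<forall>i\<in>{1..<n}. y i (Suc i) \<in> D i (Suc i) \<and> y i (Suc i) \<noteq> d i (Suc i)"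
  proof
    fix i assume "i \<in> {1..<n}"
    then have "(i, Suc i) \<in> index_pairs n" by (auto simp: index_pairs_def)
    then show "y i (Suc i) \<in> D i (Suc i) \<and> y i (Suc i) \<noteq> d i (Suc i)" using yd[of i "Suc i"] by auto
  qed
  moreover have "\<forall>i j. (i, j) \<in> index_pairs n \<longrightarrow> d i j \<in> D i j" using yd by auto
  ultimately show ?thesis by (intro exI[of _ "\<lambda>i. y i (Suc i)"] exI[of _ d]) blast
qed

lemma CF_chain_sorted:
  assumes x: "\<And>i. i \<in> {1..<n} \<Longrightarrow> x i \<in> D i (Suc i)"
  shows "sorted_wrt (\<lambda>a b. le a b \<and> a \<noteq> b) (CF_chain n u x)"
proof -
  define lt where "lt a b \<longleftrightarrow> le a b \<and> a \<noteq> b" for a b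
  have lt_trans: "lt a c" if "lt a b" "lt b c" "a \<in> V" "b \<in> V" "c \<in> V" for a b c
    using that le_trans[of a b c] le_antisym[of a b] unfolding lt_def by blast
  have xi: "x i \<in> V" "lt (u i) (x i)" "lt (x i) (u (Suc i))" "u i \<in> V" "u (Suc i) \<in> V" if "i \<in> {1..<n}" for i
    using linksD[OF x[OF that]] by (auto simp: lt_def)
  \<comment> \<open>The induction also carries that \<open>u m\<close> is the greatest element so
    far, which allows appending above it.\<close>
  have "sorted_wrt lt (CF_chain m u x) \<and>
      (\<forall>v\<in>set (CF_chain m u x). v \<in> V \<and> (v = u m \<or> lt v (u m)))" if "1 \<le> m" "m \<le> n" for m
    using that
  proof (induction m rule: dec_induct)
    case base
    then show ?case using u_red[of 1] n_ge by (auto simp: CF_chain_def)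
  next
    case (step m)
    then have m: "m \<in> {1..<n}" by auto
    note X = xi[OF m]
    have IH: "sorted_wrt lt (CF_chain m u x)"
      "\<And>v. v \<in> set (CF_chain m u x) \<Longrightarrow> v \<in> V \<and> (v = u m \<or> lt v (u m))" using step by auto
    have lx: "v \<in> V \<and> lt v (x m)" if "v \<in> set (CF_chain m u x)" for v
      using IH(2)[OF that] X lt_trans by blast
    then have "v \<in> V \<and> lt v (u (Suc m))" if "v \<in> set (CF_chain m u x)" for v
      using that X lt_trans by blast
    then show ?case using lx X IH(1) step.hyps by (auto simp: CF_chain_Suc sorted_wrt_append)
  qed
  then have "sorted_wrt lt (CF_chain n u x)" using n_ge by auto
  then show ?thesis by (simp add: lt_def[abs_def])
qed

theorem complete_representation:
  "\<exists>x c. adj_rep V le (CF_chain n u x) (CF_steps n u c) \<and>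
     (\<forall>i\<in>{1..<n}. covers V le (u i) (x i) \<and> covers V le (x i) (u (Suc i)) \<and>
        incomparable le (x i) (c (pair_index n i (Suc i))))"
proof -
  obtain x d where x: "\<And>i. i \<in> {1..<n} \<Longrightarrow> x i \<in> D i (Suc i)"
    and xd: "\<And>i. i \<in> {1..<n} \<Longrightarrow> x i \<noteq> d i (Suc i)"
    and d: "\<And>i j. (i, j) \<in> index_pairs n \<Longrightarrow> d i j \<in> D i j"
    and cover: "irr \<subseteq> x ` {1..<n} \<union> (\<lambda>(i, j). d i j) ` index_pairs n"
    using representatives by blast
  \<comment> \<open>The value at \<open>k\<close> is the link of the pair numbered \<open>k\<close>;
    at other numbers it is arbitrary.\<close>
  define c where "c k = (case inv_into (index_pairs n) (\<lambda>(i, j). pair_index n i j) k of (i, j) \<Rightarrow> d i j)" for k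
  have c: "c (pair_index n i j) = d i j" if "(i, j) \<in> index_pairs n" for i j
    using inv_into_f_f[OF inj_on_pair_index that] by (simp add: c_def)
  let ?C = "CF_chain n u x"
  define L where "L = concat (map (\<lambda>i. map (Pair i) [Suc i..<Suc n]) [1..<n])"
  define ts where "ts = map (\<lambda>(i, j). (u i, u j, c (pair_index n i j))) L"
  have steps: "CF_steps n u c = map (\<lambda>(a, b, c). (a, b, [c])) ts"
    unfolding CF_steps_eq_map ts_def L_def ..
  have setL: "set L = index_pairs n" and distL: "distinct L"
    unfolding L_def by (rule set_pair_list, rule distinct_pair_list)
  have setC: "set ?C = u ` {1..n} \<union> x ` {1..<n}" using set_CF_chain[of n] n_ge by simp
  have CV: "set ?C \<subseteq> V" unfolding setC using u_red linksD(1)[OF x] by auto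
  have sorted: "sorted_wrt (\<lambda>a b. le a b \<and> a \<noteq> b) ?C" using x by (rule CF_chain_sorted)
  have chain: "chain_le ?C v w = le v w" if "v \<in> set ?C" "w \<in> set ?C" for v w
    using chain_le_sorted[OF fin_poset_axioms sorted CV that] .
  have pairD: "i \<in> {1..<n}" if "(i, j) \<in> index_pairs n" for i j
    using that by (auto simp: index_pairs_def)
  \<comment> \<open>Both elements cover \<open>u i\<close>, and different upper covers of one
    element are incomparable.\<close>
  have x_inc: "\<not> le (x i) v \<and> \<not> le v (x i)" if i: "i \<in> {1..<n}" and v: "v \<in> D i j" "v \<noteq> x i" for i j v
  proof -
    have "\<not> le a b" if "covers V le p a" "covers V le p b" "a \<noteq> b" for p a b
      using that unfolding covers_def by blast
    then show ?thesis using linksD(3)[OF x[OF i]] linksD(3)[OF v(1)] v(2) by metis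
  qed
  have d_notin: "d i j \<in> V - set ?C" if p: "(i, j) \<in> index_pairs n" for i j
  proof -
    note W = linksD[OF d[OF p]]
    have "d i j \<noteq> u k" if "k \<in> {1..n}" for k using W u_red[of k] that by auto
    moreover have "d i j \<noteq> x k" if k: "k \<in> {1..<n}" for k
    proof
      assume eq: "d i j = x k"
      have "(k, Suc k) \<in> index_pairs n" using k by (auto simp: index_pairs_def)
      then have "i = k \<and> j = Suc k" using D_index_unique[OF d[OF p]] x[OF k] eq p by metis
      then show False using xd[OF k] eq by auto
    qed
    ultimately show ?thesis using W(1) unfolding setC by blast
  qed
  have img: "(\<lambda>(a, b, c). c) ` set ts = (\<lambda>(i, j). d i j) ` index_pairs n"
    unfolding ts_def set_map setL image_image by (rule image_cong) (auto simp: c)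
  have whole: "set ?C \<union> (\<lambda>(a, b, c). c) ` set ts = V"
  proof
    show "set ?C \<union> (\<lambda>(a, b, c). c) ` set ts \<subseteq> V" using CV d_notin unfolding img by fast
    have "V \<subseteq> u ` {1..n} \<union> irr" unfolding red[symmetric] by (auto simp: reducibles_def irr_def)
    then show "V \<subseteq> set ?C \<union> (\<lambda>(a, b, c). c) ` set ts" using cover unfolding setC img by blast
  qed
  have adj: "adj_valid (set ?C, chain_le ?C) (map (\<lambda>(a, b, c). (a, b, [c])) ts) \<and>
         fst (adj_iter (set ?C, chain_le ?C) (map (\<lambda>(a, b, c). (a, b, [c])) ts)) = set ?C \<union> (\<lambda>(a, b, c). c) ` set ts \<and>
         (\<forall>x \<in> set ?C \<union> (\<lambda>(a, b, c). c) ` set ts. \<forall>y \<in> set ?C \<union> (\<lambda>(a, b, c). c) ` set ts.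
            snd (adj_iter (set ?C, chain_le ?C) (map (\<lambda>(a, b, c). (a, b, [c])) ts)) x y = le x y)"
  proof (rule adjoin_singletons[where V = V])
    have "inj_on (\<lambda>(i, j). d i j) (index_pairs n)"
    proof (rule inj_onI, clarify)
      fix i j i' j' assume "(i, j) \<in> index_pairs n" "(i', j') \<in> index_pairs n" "d i j = d i' j'"
      then show "i = i' \<and> j = j'" using D_index_unique[of "d i j" i j i' j'] d by metis
    qed
    then have "distinct (map (\<lambda>(i, j). d i j) L)" using distL setL by (simp add: distinct_map)
    moreover have "map (\<lambda>(a, b, c). c) ts = map (\<lambda>(i, j). d i j) L"
      unfolding ts_def map_map by (rule map_cong) (auto simp: setL c)
    ultimately show "distinct (map (\<lambda>(a, b, c). c) ts)" by simp
  next
    fix a b e assume "(a, b, e) \<in> set ts"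
    then obtain i j where p: "(i, j) \<in> index_pairs n" and abe: "a = u i" "b = u j" "e = d i j"
      using c by (auto simp: ts_def setL)
    then have ij: "1 \<le> i" "i < j" "j \<le> n" by (auto simp: index_pairs_def)
    \<comment> \<open>The element \<open>x i\<close> of the base chain lies strictly between
      \<open>u i\<close> and \<open>u j\<close>, so that pair is not a covering when the singleton
      is adjoined.\<close>
    note X = linksD[OF x[OF pairD[OF p]]]
    have "le (x i) (u j)" "x i \<noteq> u j"
      using X le_trans[of "x i" "u (Suc i)" "u j"] u_le[of "Suc i" j] u_red[of j] ij by auto
    moreover have "x i \<in> set ?C" using setC pairD[OF p] by auto
    ultimately have "\<exists>z\<in>set ?C. le a z \<and> le z b \<and> z \<noteq> a \<and> z \<noteq> b"
      using X abe by (intro bexI[of _ "x i"]) auto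
    then show "a \<in> set ?C \<and> b \<in> set ?C \<and> e \<in> V - set ?C \<and> a \<noteq> b \<and> le a b \<and>
           (\<exists>z\<in>set ?C. le a z \<and> le z b \<and> z \<noteq> a \<and> z \<noteq> b)"
      using d_notin[OF p] u_less[of i j] ij abe setC by auto
    show "(le w e \<longleftrightarrow> le w a) \<and> (le e w \<longleftrightarrow> le b w)" if "w \<in> V" "w \<noteq> e" for w
      using le_link_iff[OF d[OF p], of w] that abe by auto
  qed (use CV chain le_refl in auto)
  have "maximal_chain V le (set ?C)"
    unfolding maximal_chain_def
  proof (intro conjI allI impI)
    show "set ?C \<subseteq> V" by (rule CV)
    show "is_chain le (set ?C)"
      using chain chain_le_total[of _ ?C] unfolding is_chain_def by blast
    fix T assume T: "set ?C \<subset> T \<and> T \<subseteq> V"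
    then obtain v where v: "v \<in> T" "v \<notin> set ?C" "v \<in> V" by blast
    \<comment> \<open>An element outside the base chain is some \<open>d i j\<close>, and
      \<open>x i\<close> in the chain is incomparable to it. This gives maximality.\<close>
    then obtain i j where p: "(i, j) \<in> index_pairs n" "v = d i j" using whole img by auto
    have xi: "x i \<in> set ?C" using setC pairD[OF p(1)] by auto
    then have "v \<noteq> x i" using v by blast
    then have "\<not> le (x i) v \<and> \<not> le v (x i)"
      using x_inc[OF pairD[OF p(1)], of v] d[OF p(1)] p(2) by blast
    then show "\<not> is_chain le T" using T v xi unfolding is_chain_def by blast
  qed
  moreover have "?C \<noteq> []" by (simp add: CF_chain_def)
  ultimately have "adj_rep V le ?C (CF_steps n u c)"
    using adj sorted_wrt_strict_distinct[OF sorted] unfolding adj_rep_def chain_poset_def steps whole by blast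
  moreover have "covers V le (u i) (x i) \<and> covers V le (x i) (u (Suc i)) \<and>
        incomparable le (x i) (c (pair_index n i (Suc i)))" if i: "i \<in> {1..<n}" for i
  proof -
    have p: "(i, Suc i) \<in> index_pairs n" using i by (auto simp: index_pairs_def)
    show ?thesis using linksD(3,4)[OF x[OF i]] x_inc[OF i d[OF p]] xd[OF i] c[OF p]
      by (auto simp: incomparable_def)
  qed
  ultimately show ?thesis by blast
qed

end

theorem mainTheorem9:
  fixes V :: "'a set" and le :: "'a \<Rightarrow> 'a \<Rightarrow> bool" and n :: nat and u :: "nat \<Rightarrow> 'a"
  assumes "n \<ge> 2"
    and "fundamental_basic_block V le"
    and "card (reducibles V le) = n"
    and "nullity V le = int (n choose 2)"
    and "reducibles V le = u ` {1..n}"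
    and "\<forall>i\<in>{1..n}. \<forall>j\<in>{1..n}. i < j \<longrightarrow> le (u i) (u j) \<and> u i \<noteq> u j"
  shows "\<exists>x c :: nat \<Rightarrow> 'a.
           adj_rep V le (CF_chain n u x) (CF_steps n u c) \<and>
           (\<forall>i\<in>{1..<n}. covers V le (u i) (x i) \<and> covers V le (x i) (u (Suc i)) \<and>
                          incomparable le (x i) (c (pair_index n i (Suc i)))) \<and>
           card V = 2 * n - 1 + (n choose 2) \<and>
           card (coverings V le) = (2 * n - 2) + 2 * (n choose 2) \<and>
           nullity V le = int (n choose 2)"
proof -
  have lat: "finite_lattice V le" and bb: "basic_block V le"
    using assms(2) by (auto simp: fundamental_basic_block_def RC_lattice_def)
  interpret fin_poset V le using lat by unfold_locales (auto simp: finite_lattice_def)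
  obtain C0 steps where rep: "adj_rep V le C0 steps" "distinct (adj_pairs steps)"
    using assms(2) by (auto simp: fundamental_basic_block_def)
  \<comment> \<open>The given representation is used only to supply levels, which yield the bounds
    on \<open>links\<close>; the desired representation is built afresh.\<close>
  obtain lev A B where "levelled V le lev A B (length steps)"
    using adjunct_chains_levelled[OF _ rep(2) fin_poset_axioms] rep(1) unfolding adj_rep_def by blast
  then interpret levelled V le lev A B "length steps" .
  have "card (reducibles V le) \<le> card V"
    using finite_carrier by (intro card_mono) (auto simp: reducibles_def)
  then have card: "2 \<le> card V" using assms by simp
  have glb: "\<exists>z. is_glb V le x y z" if "x \<in> V" "y \<in> V" for x y
    using lat that by (auto simp: finite_lattice_def)
  have ne: "V \<noteq> {}" using lat by (simp add: finite_lattice_def)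
  obtain m where m: "m \<in> V" "\<And>x. x \<in> V \<Longrightarrow> le m x" using exists_bottom[OF ne glb] by blast
  interpret complete_block V le n u
  proof (unfold_locales, goal_cases)
    case (4 x)
    then show ?case using irreducible_covers[OF lat bb card] by blast
  next
    case (6 p q r)
    then show ?case by (rule card_links_le_1)
  qed (use assms card_links_le_2 num_components_bot[OF m] in auto)
  have irr: "card irr = (n choose 2) + (n - 1)" by (rule card_irr_eq)
  have "card (coverings V le) = (2 * n - 2) + 2 * (n choose 2)"
    using card_coverings irr consec_empty by simp
  moreover have "card V = 2 * n - 1 + (n choose 2)"
    using card_carrier irr n_ge by simp
  ultimately show ?thesis using complete_representation assms(4) by blast
qed

end
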